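(* Let $G$ be a finitely generated group and let $\mu$ be a non-degenerate probability measure on $G$. Let $\overline{G}$ be the torsion-free part of the abelianisation of $G$, let $\pi: G\to\overline{G}$ be the natural projection, and let $\bar\mu=\pi_*(\mu)$. Then $G$ is amenable if and only if $\lambda(G,\mu)=\lambda(\overline{G},\bar\mu)$.
   Context: A probability measure on a countable group $G$ is a function $\mu:G\to[0,\infty)$ with $\sum_{g\in G}\mu(g)=1$; its support is $S_\mu=\{g\in G:\mu(g)>0\}$ (not assumed finite). $\mu$ is non-degenerate if $S_\mu$ generates $G$ as a semigroup. Convolution is $\mu*\nu(g)=\sum_{s\in G}\mu(s)\nu(s^{-1}g)$, and $\mu^{*n}$ denotes the $n$-fold convolution power. The spectral radius is $\lambda(G,\mu)=\limsup_{n\to\infty}(\mu^{*n}(e))^{1/n}$, where $e$ is the identity of $G$. Let $G^{\mathrm{ab}}=G/[G,G]$, let $G^{\mathrm{ab}}_{\mathrm T}$ be its torsion subgroup, and let $\overline{G}=G^{\mathrm{ab}}/G^{\mathrm{ab}}_{\mathrm T}\cong\mathbb{Z}^k$ for some $k\ge 0$, with $\pi:G\to\overline{G}$ the natural projection homomorphism. The pushforward is $\bar\mu(m)=\sum_{g\in G,\ \pi(g)=m}\mu(g)$ for $m\in\overline{G}$, and $\lambda(\overline{G},\bar\mu)=\limsup_{n\to\infty}(\bar\mu^{*n}(0))^{1/n}$. $G$ is amenable if there is a linear functional $M:\ell^\infty(G)\to\mathbb{R}$ (a Banach mean) with $M(1)=1$, $\inf_{g} f(g)\le M(f)\le\sup_{g}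 f(g)$, and $M(f_g)=M(f)$ for all $g\in G$, where $f_g(x)=f(gx)$. *)

theory Defs
  imports "HOL-Analysis.Analysis" "HOL-Algebra.Generated_Groups"
begin

text \<open>A measure on a group is a real-valued function on the underlying type. Only its values on
  the carrier matter: every sum below ranges over (a subset of) the carrier.\<close>

definition prob_measure_on :: "('a, 'b) monoid_scheme \<Rightarrow> ('a \<Rightarrow> real) \<Rightarrow> bool" where
  "prob_measure_on G \<mu> \<longleftrightarrow> (\<forall>g\<in>carrier G. 0 \<le> \<mu> g) \<and> (\<mu> has_sum 1) (carrier G)"

definition measure_support :: "('a, 'b) monoid_scheme \<Rightarrow> ('a \<Rightarrow> real) \<Rightarrow> 'a set" where
  "measure_support G \<mu> = {g \<in> carrier G. 0 < \<mu> g}"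

inductive_set semigroup_generate :: "('a, 'b) monoid_scheme \<Rightarrow> 'a set \<Rightarrow> 'a set"
  for G and S where
  incl: "s \<in> S \<Longrightarrow> s \<in> semigroup_generate G S"
| mult: "x \<in> semigroup_generate G S \<Longrightarrow> y \<in> semigroup_generate G S
           \<Longrightarrow> x \<otimes>\<^bsub>G\<^esub> y \<in> semigroup_generate G S"

definition nondegenerate :: "('a, 'b) monoid_scheme \<Rightarrow> ('a \<Rightarrow> real) \<Rightarrow> bool" where
  "nondegenerate G \<mu> \<longleftrightarrow> semigroup_generate G (measure_support G \<mu>) = carrier G"

definition convolution ::
    "('a, 'b) monoid_scheme \<Rightarrow> ('a \<Rightarrow> real) \<Rightarrow> ('a \<Rightarrow> real) \<Rightarrow> 'a \<Rightarrow> real" where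
  "convolution G \<mu> \<nu> g = (\<Sum>\<^sub>\<infinity>s\<in>carrier G. \<mu> s * \<nu> (inv\<^bsub>G\<^esub> s \<otimes>\<^bsub>G\<^esub> g))"

primrec conv_power :: "('a, 'b) monoid_scheme \<Rightarrow> ('a \<Rightarrow> real) \<Rightarrow> nat \<Rightarrow> 'a \<Rightarrow> real" where
  "conv_power G \<mu> 0 = (\<lambda>g. if g = \<one>\<^bsub>G\<^esub> then 1 else 0)"
| "conv_power G \<mu> (Suc n) = convolution G \<mu> (conv_power G \<mu> n)"

text \<open>The limit superior is taken in the extended reals, where it always exists; for a
  probability measure the sequence lies in the unit interval.\<close>

definition spectral_radius :: "('a, 'b) monoid_scheme \<Rightarrow> ('a \<Rightarrow> real) \<Rightarrow> ereal" where
  "spectral_radius G \<mu> = limsup (\<lambda>n. ereal (root n (conv_power G \<mu> n \<one>\<^bsub>G\<^esub>)))"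

definition finitely_generated :: "('a, 'b) monoid_scheme \<Rightarrow> bool" where
  "finitely_generated G \<longleftrightarrow> (\<exists>S. finite S \<and> S \<subseteq> carrier G \<and> generate G S = carrier G)"

definition abelianisation :: "('a, 'b) monoid_scheme \<Rightarrow> 'a set monoid" where
  "abelianisation G = G Mod derived G (carrier G)"

definition torsion_subgroup :: "('a, 'b) monoid_scheme \<Rightarrow> 'a set" where
  "torsion_subgroup A = {x \<in> carrier A. \<exists>n::nat. n > 0 \<and> x [^]\<^bsub>A\<^esub> n = \<one>\<^bsub>A\<^esub>}"

definition torsion_free_abelianisation :: "('a, 'b) monoid_scheme \<Rightarrow> 'a set set monoid" where
  "torsion_free_abelianisation G = abelianisation G Mod torsion_subgroup (abelianisation G)"

definition natural_projection :: "('a, 'b) monoid_scheme \<Rightarrow> 'a \<Rightarrow> 'a set set" where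
  "natural_projection G g =
     torsion_subgroup (abelianisation G) #>\<^bsub>abelianisation G\<^esub> (derived G (carrier G) #>\<^bsub>G\<^esub> g)"

definition pushforward ::
    "('a, 'b) monoid_scheme \<Rightarrow> ('a \<Rightarrow> 'c) \<Rightarrow> ('a \<Rightarrow> real) \<Rightarrow> 'c \<Rightarrow> real" where
  "pushforward G \<pi> \<mu> m = (\<Sum>\<^sub>\<infinity>g\<in>{g \<in> carrier G. \<pi> g = m}. \<mu> g)"

text \<open>Elements of \<open>linfty G\<close> are functions on the whole type, bounded on the carrier. The bounds
  in \<open>banach_mean\<close> together with linearity force a mean to depend only on the restriction of its
  argument to the carrier: if two functions agree there, their difference has infimum and supremum 0.\<close>

definition linfty :: "('a, 'b) monoid_scheme \<Rightarrow> ('a \<Rightarrow> real) set" where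
  "linfty G = {f. bounded (f ` carrier G)}"

definition banach_mean :: "('a, 'b) monoid_scheme \<Rightarrow> (('a \<Rightarrow> real) \<Rightarrow> real) \<Rightarrow> bool" where
  "banach_mean G M \<longleftrightarrow>
     (\<forall>f\<in>linfty G. \<forall>h\<in>linfty G. M (\<lambda>x. f x + h x) = M f + M h) \<and>
     (\<forall>c. \<forall>f\<in>linfty G. M (\<lambda>x. c * f x) = c * M f) \<and>
     M (\<lambda>_. 1) = 1 \<and>
     (\<forall>f\<in>linfty G. (INF g\<in>carrier G. f g) \<le> M f \<and> M f \<le> (SUP g\<in>carrier G. f g)) \<and>
     (\<forall>f\<in>linfty G. \<forall>g\<in>carrier G. M (\<lambda>x. f (g \<otimes>\<^bsub>G\<^esub> x)) = M f)"

definition amenable :: "('a, 'b) monoid_scheme \<Rightarrow> bool" where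
  "amenable G \<longleftrightarrow> (\<exists>M. banach_mean G M)"

end

(*  For an additive character xi of G write phi(xi) for the sum of mu(s) exp(xi(s)). Every
    character bounds the spectral radius by phi(xi). If G is amenable this is sharp: for
    r > lambda(G, mu) the Green function F, the sum of r^(-n) times the n-th convolution power,
    converges, and xi(g) = - M(x |-> ln F(gx) - ln F(x)), with M an invariant mean, satisfies
    phi(xi) <= r.
    Characters of G are the same as characters of its torsion-free abelianisation, which is
    itself amenable, so amenability of G makes both spectral radii equal to inf phi.

    Conversely, if the radii agree, there are characters with phi(xi) <= r for every
    r > lambda(G, mu). The measures mu exp(xi) / r are sub-probabilities of spectral radius close
    to 1, and as r decreases to lambda(G, mu) each point of the support keeps a mass bounded below.
    Powers of the corresponding lazy walks then contain almost invariant vectors in l^2(G), and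
    these produce an invariant mean, as in Kesten's theorem. *)

theory Submission
  imports Defs
begin

text \<open>No symmetry or moment condition is imposed on \<open>\<mu>\<close>, so convolution need
  not be self-adjoint and phi may be infinite. The spectral theorem is replaced by the decay of
  square norms: if every lazy step shrank the square norm by a fixed factor, the values at the
  identity would decay too fast for the given spectral radius. So some step loses almost nothing,
  and the loss in that step dominates the mass of each g times the squared distance between the
  vector and its translate by g. A change of character could let the mass of g vanish as r
  decreases. This is excluded by looking at the inverse of g: if that is reached in m steps with
  weight c > 0, then c exp(-xi(g)) <= r^m, which bounds exp(xi(g)) below whatever the character is.
  The radius r stays strictly above lambda(G, mu) because the Green series may diverge at lambda
  itself; for the same reason the converse works with a sequence of characters and one vector for
  each of them.\<close>

subsection \<open>Finitely additive means\<close>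

text \<open>Invariance is kept separate, since it is gained element by element or only in a limit.
  The bound by constants is a closed condition, hence passes to limits, and negation turns it into a
  lower bound.\<close>

definition fa_mean :: "('a, 'b) monoid_scheme \<Rightarrow> (('a \<Rightarrow> real) \<Rightarrow> real) \<Rightarrow> bool" where
  "fa_mean G M \<longleftrightarrow>
     (\<forall>f\<in>linfty G. \<forall>h\<in>linfty G. M (\<lambda>x. f x + h x) = M f + M h) \<and>
     (\<forall>c. \<forall>f\<in>linfty G. M (\<lambda>x. c * f x) = c * M f) \<and>
     (\<forall>f\<in>linfty G. \<forall>c. (\<forall>x\<in>carrier G. f x \<le> c) \<longrightarrow> M f \<le> c)"

lemma linftyI: "(\<And>x. x \<in> carrier G \<Longrightarrow> \<bar>f x\<bar> \<le> c) \<Longrightarrow> f \<in> linfty G"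
  by (auto simp: linfty_def bounded_iff)

lemma linfty_bound: "f \<in> linfty G \<Longrightarrow> \<exists>c. \<forall>x\<in>carrier G. \<bar>f x\<bar> \<le> c"
  by (simp add: linfty_def bounded_iff)

lemma linfty_add: "f \<in> linfty G \<Longrightarrow> h \<in> linfty G \<Longrightarrow> (\<lambda>x. f x + h x) \<in> linfty G"
  by (auto simp: linfty_def intro: bounded_plus_comp)

lemma linfty_cmult: "f \<in> linfty G \<Longrightarrow> (\<lambda>x. c * f x) \<in> linfty G"
  unfolding linfty_def using bounded_scaling[of "f ` carrier G" c] by (simp add: image_image)

lemma linfty_const: "(\<lambda>x. c) \<in> linfty G"
  by (rule linftyI[of _ _ "\<bar>c\<bar>"]) simp

lemma linfty_translate:
  assumes "group G" "f \<in> linfty G" "g \<in> carrier G"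
  shows "(\<lambda>x. f (g \<otimes>\<^bsub>G\<^esub> x)) \<in> linfty G"
proof -
  interpret group G by fact
  obtain c where "\<And>x. x \<in> carrier G \<Longrightarrow> \<bar>f x\<bar> \<le> c" using linfty_bound[OF assms(2)] by blast
  then show ?thesis using assms(3) by (intro linftyI[of _ _ c]) auto
qed

lemma fa_mean_add:
  "fa_mean G M \<Longrightarrow> f \<in> linfty G \<Longrightarrow> h \<in> linfty G \<Longrightarrow> M (\<lambda>x. f x + h x) = M f + M h"
  by (simp add: fa_mean_def)

lemma fa_mean_cmult: "fa_mean G M \<Longrightarrow> f \<in> linfty G \<Longrightarrow> M (\<lambda>x. c * f x) = c * M f"
  by (simp add: fa_mean_def)

lemma fa_mean_upper:
  "fa_mean G M \<Longrightarrow> f \<in> linfty G \<Longrightarrow> (\<And>x. x \<in> carrier G \<Longrightarrow> f x \<le> c) \<Longrightarrow> M f \<le> c"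
  by (simp add: fa_mean_def)

lemma fa_mean_lower:
  assumes "fa_mean G M" "f \<in> linfty G" "\<And>x. x \<in> carrier G \<Longrightarrow> c \<le> f x"
  shows "c \<le> M f"
  using fa_mean_upper[OF assms(1) linfty_cmult[OF assms(2), of "-1"], of "-c"] assms
    fa_mean_cmult[OF assms(1,2), of "-1"] by simp

lemma fa_mean_const:
  assumes "fa_mean G M"
  shows "M (\<lambda>x. c) = c"
proof (rule antisym)
  show "M (\<lambda>x. c) \<le> c" by (rule fa_mean_upper[OF assms linfty_const]) simp
  show "c \<le> M (\<lambda>x. c)" by (rule fa_mean_lower[OF assms linfty_const]) simp
qed

lemma fa_mean_diff:
  assumes "fa_mean G M" "f \<in> linfty G" "h \<in> linfty G"
  shows "M (\<lambda>x. f x - h x) = M f - M h"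
  using fa_mean_add[OF assms(1,2) linfty_cmult[OF assms(3), of "-1"]]
    fa_mean_cmult[OF assms(1,3), of "-1"] by simp

lemma fa_mean_mono:
  assumes "fa_mean G M" "f \<in> linfty G" "h \<in> linfty G" "\<And>x. x \<in> carrier G \<Longrightarrow> f x \<le> h x"
  shows "M f \<le> M h"
proof -
  have "(\<lambda>x. h x - f x) \<in> linfty G"
    using linfty_add[OF assms(3) linfty_cmult[OF assms(2), of "-1"]] by simp
  then have "0 \<le> M (\<lambda>x. h x - f x)"
    using assms(4) by (intro fa_mean_lower[OF assms(1)]) auto
  then show ?thesis using fa_mean_diff[OF assms(1,3,2)] by simp
qed

lemma fa_mean_cong:
  assumes "fa_mean G M" "f \<in> linfty G" "h \<in> linfty G" "\<And>x. x \<in> carrier G \<Longrightarrow> f x = h x"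
  shows "M f = M h"
  by (intro antisym fa_mean_mono[OF assms(1)]) (simp_all add: assms)

lemma fa_mean_sum:
  assumes "fa_mean G M" "finite I" "\<And>i. i \<in> I \<Longrightarrow> f i \<in> linfty G"
  shows "(\<lambda>x. \<Sum>i\<in>I. f i x) \<in> linfty G \<and> M (\<lambda>x. \<Sum>i\<in>I. f i x) = (\<Sum>i\<in>I. M (f i))"
  using assms(2,3)
proof (induction I rule: finite_induct)
  case empty
  then show ?case using fa_mean_const[OF assms(1), of 0] linfty_const[of 0 G] by simp
next
  case (insert i I)
  then have "(\<lambda>x. \<Sum>j\<in>I. f j x) \<in> linfty G" "f i \<in> linfty G"
    and IH: "M (\<lambda>x. \<Sum>j\<in>I. f j x) = (\<Sum>j\<in>I. M (f j))" by auto
  note add = linfty_add[OF this(2,1)] fa_mean_add[OF assms(1) this(2,1)]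
  from add show ?case unfolding sum.insert[OF insert(1,2)] IH by (rule conjI)
qed

lemma banach_mean_iff:
  assumes "carrier G \<noteq> {}"
  shows "banach_mean G M \<longleftrightarrow>
    fa_mean G M \<and> (\<forall>f\<in>linfty G. \<forall>g\<in>carrier G. M (\<lambda>x. f (g \<otimes>\<^bsub>G\<^esub> x)) = M f)"
proof
  assume M: "banach_mean G M"
  have "M f \<le> c" if f: "f \<in> linfty G" "\<And>x. x \<in> carrier G \<Longrightarrow> f x \<le> c" for f c
  proof -
    have "M f \<le> (SUP g\<in>carrier G. f g)" using M f(1) by (simp add: banach_mean_def)
    also have "\<dots> \<le> c" using assms f(2) by (rule cSUP_least)
    finally show ?thesis .
  qed
  with M show "fa_mean G M \<and> (\<forall>f\<in>linfty G. \<forall>g\<in>carrier G. M (\<lambda>x. f (g \<otimes>\<^bsub>G\<^esub> x)) = M f)"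
    by (simp add: banach_mean_def fa_mean_def)
next
  assume M: "fa_mean G M \<and> (\<forall>f\<in>linfty G. \<forall>g\<in>carrier G. M (\<lambda>x. f (g \<otimes>\<^bsub>G\<^esub> x)) = M f)"
  have "(INF g\<in>carrier G. f g) \<le> M f" "M f \<le> (SUP g\<in>carrier G. f g)" if f: "f \<in> linfty G" for f
  proof -
    have "bdd_above (f ` carrier G)" "bdd_below (f ` carrier G)"
      using f by (auto simp: linfty_def bounded_imp_bdd_above bounded_imp_bdd_below)
    then show "(INF g\<in>carrier G. f g) \<le> M f" "M f \<le> (SUP g\<in>carrier G. f g)"
      using M f by (auto intro!: fa_mean_lower[of G M f] fa_mean_upper[of G M f] cINF_lower cSUP_upper)
  qed
  with M fa_mean_const[of G M 1] show "banach_mean G M"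
    unfolding banach_mean_def fa_mean_def[of G M] by blast
qed

text \<open>The limit is a cluster point in the product of compact intervals (Tychonoff).\<close>

lemma fa_mean_limit:
  fixes M :: "nat \<Rightarrow> ('a \<Rightarrow> real) \<Rightarrow> real"
  assumes M: "\<And>n. fa_mean G (M n)"
  obtains L where "fa_mean G L"
    "\<And>f h. f \<in> linfty G \<Longrightarrow> h \<in> linfty G \<Longrightarrow> (\<lambda>n. M n f - M n h) \<longlonglongrightarrow> 0 \<Longrightarrow> L f = L h"
proof -
  \<comment> \<open>Outside \<open>linfty G\<close> the functionals are uncontrolled; the value 0
    there confines every coordinate to a compact interval.\<close>
  define N where "N n f = (if f \<in> linfty G then M n f else 0)" for n f
  have "\<exists>b. \<forall>n. N n f \<in> {-b..b}" for f
  proof (cases "f \<in> linfty G")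
    case True
    obtain b where b: "\<And>x. x \<in> carrier G \<Longrightarrow> \<bar>f x\<bar> \<le> b" using linfty_bound[OF True] by blast
    then have "f x \<le> b" "-b \<le> f x" if "x \<in> carrier G" for x
      using that by (meson abs_le_D1 abs_le_iff minus_le_iff)+
    then have "N n f \<in> {-b..b}" for n
      using True fa_mean_upper[OF M True, of b n] fa_mean_lower[OF M True, of "-b" n] b
      by (simp add: N_def)
    then show ?thesis by blast
  next
    case False
    then show ?thesis by (intro exI[of _ 0]) (simp add: N_def)
  qed
  then obtain b where b: "\<And>n f. N n f \<in> {-b f..b f}" by metis
  have "compactin (product_topology (\<lambda>i. euclidean) UNIV) (PiE UNIV (\<lambda>f. {-b f..b f}))"
    by (subst compactin_PiE) simp
  then have K: "compact (PiE UNIV (\<lambda>f. {-b f..b f}))"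
    by (simp add: euclidean_product_topology)
  define F where "F = filtermap N sequentially"
  have "F \<noteq> bot" "eventually (\<lambda>x. x \<in> PiE UNIV (\<lambda>f. {-b f..b f})) F"
    unfolding F_def filtermap_bot_iff eventually_filtermap
    using b by (simp_all add: PiE_def Pi_def)
  with K obtain L where L: "inf (nhds L) F \<noteq> bot"
    unfolding compact_filter by blast
  \<comment> \<open>\<open>H\<close> refines both the neighbourhoods of \<open>L\<close> and the
    tails of the sequence, so identities valid for all \<open>N n\<close>, and limits along the
    sequence, carry over to \<open>L\<close>.\<close>
  define H where "H = inf (nhds L) F"
  have H: "H \<noteq> bot" "H \<le> nhds L" "H \<le> F" using L by (auto simp: H_def)
  have lim: "((\<lambda>P. P f) \<longlongrightarrow> L f) H" for f
  proof -
    have "continuous_on UNIV (\<lambda>P :: ('a \<Rightarrow> real) \<Rightarrow> real. P f)"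
      by (rule continuous_on_product_coordinates)
    then have "((\<lambda>P. P f) \<longlongrightarrow> L f) (at L)" by (simp add: continuous_on_def)
    then have "((\<lambda>P. P f) \<longlongrightarrow> L f) (nhds L)"
      using tendsto_at_iff_tendsto_nhds[of "\<lambda>P. P f" L] by simp
    then show ?thesis using H(2) tendsto_mono by blast
  qed
  have ev: "eventually Q H" if "\<And>n. Q (N n)" for Q
    using H(3) by (rule filter_leD) (simp add: F_def eventually_filtermap that)
  have "fa_mean G L"
    unfolding fa_mean_def
  proof (intro conjI ballI allI impI)
    fix f h assume f: "f \<in> linfty G" and h: "h \<in> linfty G"
    have "eventually (\<lambda>P. P (\<lambda>x. f x + h x) = P f + P h) H"
      by (rule ev) (simp add: N_def f h linfty_add fa_mean_add[OF M])
    with lim have "((\<lambda>P. P f + P h) \<longlongrightarrow> L (\<lambda>x. f x + h x)) H"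
      by (rule Lim_transform_eventually)
    then show "L (\<lambda>x. f x + h x) = L f + L h"
      using tendsto_unique[OF H(1) _ tendsto_add[OF lim lim]] by blast
  next
    fix c f assume f: "f \<in> linfty G"
    have "eventually (\<lambda>P. P (\<lambda>x. c * f x) = c * P f) H"
      by (rule ev) (simp add: N_def f linfty_cmult fa_mean_cmult[OF M])
    with lim have "((\<lambda>P. c * P f) \<longlongrightarrow> L (\<lambda>x. c * f x)) H"
      by (rule Lim_transform_eventually)
    then show "L (\<lambda>x. c * f x) = c * L f"
      using tendsto_unique[OF H(1) _ tendsto_mult[OF tendsto_const lim]] by blast
  next
    fix f c assume f: "f \<in> linfty G" "\<forall>x\<in>carrier G. f x \<le> c"
    have "eventually (\<lambda>P. P f \<le> c) H"
      by (rule ev) (use f in \<open>simp add: N_def fa_mean_upper[OF M]\<close>)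
    then show "L f \<le> c" using tendsto_upperbound[OF lim _ H(1)] by blast
  qed
  moreover have "L f = L h"
    if "f \<in> linfty G" "h \<in> linfty G" "(\<lambda>n. M n f - M n h) \<longlonglongrightarrow> 0" for f h
  proof -
    have "((\<lambda>P. P f - P h) \<longlongrightarrow> 0) F"
      unfolding F_def filterlim_filtermap using that by (simp add: N_def)
    then have "((\<lambda>P. P f - P h) \<longlongrightarrow> 0) H" using H(3) tendsto_mono by blast
    then have "L f - L h = 0"
      using tendsto_unique[OF H(1) tendsto_diff[OF lim lim]] by blast
    then show ?thesis by simp
  qed
  ultimately show ?thesis by (rule that)
qed

section \<open>Amenability from invariance under generators; commutative groups\<close>

text \<open>The elements leaving a mean invariant form a subgroup.\<close>

lemma amenableI:
  assumes "group G" "fa_mean G M" "S \<subseteq> carrier G" "generate G S = carrier G"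
    and inv: "\<And>f s. f \<in> linfty G \<Longrightarrow> s \<in> S \<Longrightarrow> M (\<lambda>x. f (s \<otimes>\<^bsub>G\<^esub> x)) = M f"
  shows "amenable G"
proof -
  interpret group G by fact
  have ext: "M f = M h" if "f \<in> linfty G" "h \<in> linfty G" "\<And>x. x \<in> carrier G \<Longrightarrow> f x = h x" for f h
    using fa_mean_cong[OF assms(2) that] .
  have "\<forall>f\<in>linfty G. M (\<lambda>x. f (g \<otimes>\<^bsub>G\<^esub> x)) = M f" if "g \<in> generate G S" for g
    using that
  proof induction
    case one
    show ?case
    proof
      fix f assume f: "f \<in> linfty G"
      show "M (\<lambda>x. f (\<one>\<^bsub>G\<^esub> \<otimes>\<^bsub>G\<^esub> x)) = M f"
        by (rule ext[OF linfty_translate[OF assms(1) f one_closed] f]) simp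
    qed
  next
    case (incl h)
    show ?case using inv incl by (intro ballI)
  next
    case (inv h)
    then have h: "h \<in> carrier G" using assms(3) by auto
    show ?case
    proof
      fix f assume f: "f \<in> linfty G"
      \<comment> \<open>Invariance under \<open>h\<close> is applied to the translate of
        \<open>f\<close> by \<open>inv h\<close>, where the two translations cancel.\<close>
      have "M (\<lambda>x. f (inv\<^bsub>G\<^esub> h \<otimes>\<^bsub>G\<^esub> (h \<otimes>\<^bsub>G\<^esub> x))) = M (\<lambda>x. f (inv\<^bsub>G\<^esub> h \<otimes>\<^bsub>G\<^esub> x))"
        by (rule assms(5)[OF linfty_translate[OF assms(1) f inv_closed[OF h]] inv])
      moreover have "M (\<lambda>x. f (inv\<^bsub>G\<^esub> h \<otimes>\<^bsub>G\<^esub> (h \<otimes>\<^bsub>G\<^esub> x))) = M f"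
      proof (rule ext)
        show "(\<lambda>x. f (inv\<^bsub>G\<^esub> h \<otimes>\<^bsub>G\<^esub> (h \<otimes>\<^bsub>G\<^esub> x))) \<in> linfty G"
          using linfty_translate[OF assms(1) linfty_translate[OF assms(1) f inv_closed[OF h]] h] .
        show "f (inv\<^bsub>G\<^esub> h \<otimes>\<^bsub>G\<^esub> (h \<otimes>\<^bsub>G\<^esub> x)) = f x" if "x \<in> carrier G" for x
          using h that by (simp add: m_assoc[symmetric])
      qed (rule f)
      ultimately show "M (\<lambda>x. f (inv\<^bsub>G\<^esub> h \<otimes>\<^bsub>G\<^esub> x)) = M f" by simp
    qed
  next
    case (eng h1 h2)
    then have h: "h1 \<in> carrier G" "h2 \<in> carrier G" using assms(4) by auto
    show ?case
    proof
      fix f assume f: "f \<in> linfty G"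
      note f1 = linfty_translate[OF assms(1) f h(1)]
      have "M (\<lambda>x. f (h1 \<otimes>\<^bsub>G\<^esub> h2 \<otimes>\<^bsub>G\<^esub> x)) = M (\<lambda>x. f (h1 \<otimes>\<^bsub>G\<^esub> (h2 \<otimes>\<^bsub>G\<^esub> x)))"
        by (rule ext[OF linfty_translate[OF assms(1) f m_closed[OF h]]
              linfty_translate[OF assms(1) f1 h(2)]]) (simp add: h m_assoc)
      also have "\<dots> = M f" using bspec[OF eng.IH(2) f1] bspec[OF eng.IH(1) f] by (rule trans)
      finally show "M (\<lambda>x. f (h1 \<otimes>\<^bsub>G\<^esub> h2 \<otimes>\<^bsub>G\<^esub> x)) = M f" .
    qed
  qed
  then show ?thesis
    unfolding amenable_def using banach_mean_iff[of G] assms(2,4) one_closed by blast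
qed

text \<open>Elements are added one at a time, as in the Markov-Kakutani theorem: averaging over the
  powers of the new element and passing to a limit gives invariance under it, and by commutativity
  the averages keep the invariance already gained.\<close>

lemma comm_group_invariant_mean:
  assumes "comm_group G" "finite T" "T \<subseteq> carrier G"
  shows "\<exists>M. fa_mean G M \<and> (\<forall>f\<in>linfty G. \<forall>g\<in>T. M (\<lambda>x. f (g \<otimes>\<^bsub>G\<^esub> x)) = M f)"
  using assms(2,3)
proof (induction T rule: finite_induct)
  case empty
  interpret comm_group G by fact
  have "fa_mean G (\<lambda>f. f \<one>\<^bsub>G\<^esub>)" by (auto simp: fa_mean_def)
  then show ?case by blast
next
  case (insert g T)
  interpret comm_group G by fact
  have grp: "group G" by (rule group_axioms)
  from insert obtain M where M: "fa_mean G M"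
    and MT: "\<And>f h. f \<in> linfty G \<Longrightarrow> h \<in> T \<Longrightarrow> M (\<lambda>x. f (h \<otimes>\<^bsub>G\<^esub> x)) = M f" by auto
  have g: "g \<in> carrier G" and T: "T \<subseteq> carrier G" using insert by auto
  have gn: "g [^]\<^bsub>G\<^esub> (n::nat) \<in> carrier G" for n using g by simp
  define A where "A f n = M (\<lambda>x. f (g [^]\<^bsub>G\<^esub> (n::nat) \<otimes>\<^bsub>G\<^esub> x))" for f n
  define M' where "M' N f = (\<Sum>n<Suc N. A f n) / real (Suc N)" for N f
  have A_bound: "A f n \<le> c" if "f \<in> linfty G" "\<And>x. x \<in> carrier G \<Longrightarrow> f x \<le> c" for f n c
    unfolding A_def
    using fa_mean_upper[OF M linfty_translate[OF grp that(1) gn]] that(2) gn by simp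
  have M': "fa_mean G (M' N)" for N
    unfolding fa_mean_def
  proof (intro conjI ballI allI impI)
    fix f h assume "f \<in> linfty G" "h \<in> linfty G"
    then have "A (\<lambda>x. f x + h x) n = A f n + A h n" for n
      unfolding A_def by (intro fa_mean_add[OF M] linfty_translate[OF grp _ gn])
    then show "M' N (\<lambda>x. f x + h x) = M' N f + M' N h"
      by (simp only: M'_def sum.distrib add_divide_distrib)
  next
    fix c f assume "f \<in> linfty G"
    then have "A (\<lambda>x. c * f x) n = c * A f n" for n
      unfolding A_def by (intro fa_mean_cmult[OF M] linfty_translate[OF grp _ gn])
    then show "M' N (\<lambda>x. c * f x) = c * M' N f"
      by (simp only: M'_def sum_distrib_left[symmetric] times_divide_eq_right)
  next
    fix f c assume "f \<in> linfty G" "\<forall>x\<in>carrier G. f x \<le> c"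
    then have "A f n \<le> c" for n by (intro A_bound) auto
    then have "(\<Sum>n<Suc N. A f n) \<le> real (Suc N) * c"
      using sum_bounded_above[of "{..<Suc N}" "A f" c] by (simp only: card_lessThan)
    then show "M' N f \<le> c" by (simp add: M'_def field_simps)
  qed
  \<comment> \<open>Shifting by \<open>g\<close> makes the average telescope, so only its two end
    terms remain, each of size at most \<open>c\<close>.\<close>
  have diff: "\<bar>M' N (\<lambda>x. f (g \<otimes>\<^bsub>G\<^esub> x)) - M' N f\<bar> \<le> 2 * c / real (Suc N)"
    if f: "f \<in> linfty G" and c: "\<And>x. x \<in> carrier G \<Longrightarrow> \<bar>f x\<bar> \<le> c" for f c N
  proof -
    have "A (\<lambda>x. f (g \<otimes>\<^bsub>G\<^esub> x)) n = A f (Suc n)" for n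
      unfolding A_def
    proof (intro fa_mean_cong[OF M])
      show "(\<lambda>x. f (g \<otimes>\<^bsub>G\<^esub> (g [^]\<^bsub>G\<^esub> n \<otimes>\<^bsub>G\<^esub> x))) \<in> linfty G"
        using linfty_translate[OF grp linfty_translate[OF grp f g] gn] .
      show "(\<lambda>x. f (g [^]\<^bsub>G\<^esub> Suc n \<otimes>\<^bsub>G\<^esub> x)) \<in> linfty G" using linfty_translate[OF grp f gn] .
    qed (use g gn in \<open>simp_all add: m_assoc[symmetric] m_comm\<close>)
    then have "(\<Sum>n<Suc N. A (\<lambda>x. f (g \<otimes>\<^bsub>G\<^esub> x)) n) - (\<Sum>n<Suc N. A f n) = A f (Suc N) - A f 0"
      using sum_lessThan_telescope[of "A f" "Suc N"] by (simp only: sum_subtractf)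
    moreover have "\<bar>A f n\<bar> \<le> c" for n
    proof (rule abs_leI)
      show "A f n \<le> c" using A_bound[OF f] c abs_le_D1 by blast
      have "- c \<le> A f n" unfolding A_def
      proof (intro fa_mean_lower[OF M] linfty_translate[OF grp f gn])
        show "- c \<le> f (g [^]\<^bsub>G\<^esub> n \<otimes>\<^bsub>G\<^esub> x)" if "x \<in> carrier G" for x
          using c[OF m_closed[OF gn that], of n] by linarith
      qed
      then show "- A f n \<le> c" by simp
    qed
    from this[of "Suc N"] this[of 0] have "\<bar>A f (Suc N) - A f 0\<bar> \<le> 2 * c" by linarith
    ultimately show ?thesis
      unfolding M'_def diff_divide_distrib[symmetric] by (simp add: divide_right_mono)
  qed
  obtain L where L: "fa_mean G L"
    "\<And>f h. f \<in> linfty G \<Longrightarrow> h \<in> linfty G \<Longrightarrow> (\<lambda>n. M' n f - M' n h) \<longlonglongrightarrow> 0 \<Longrightarrow> L f = L h"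
    using fa_mean_limit[of G M'] M' by blast
  have "L (\<lambda>x. f (h \<otimes>\<^bsub>G\<^esub> x)) = L f" if f: "f \<in> linfty G" and h: "h \<in> insert g T" for f h
  proof (cases "h = g")
    case True
    obtain c where c: "\<And>x. x \<in> carrier G \<Longrightarrow> \<bar>f x\<bar> \<le> c" using linfty_bound[OF f] by blast
    have "(\<lambda>N. 2 * c / real (Suc N)) \<longlonglongrightarrow> 0"
      using LIMSEQ_Suc[OF lim_const_over_n[of "2 * c"]] by simp
    moreover have "norm (M' N (\<lambda>x. f (g \<otimes>\<^bsub>G\<^esub> x)) - M' N f) \<le> 2 * c / real (Suc N)" for N
      using diff[OF f c] by (simp only: real_norm_def)
    ultimately have "(\<lambda>N. M' N (\<lambda>x. f (g \<otimes>\<^bsub>G\<^esub> x)) - M' N f) \<longlonglongrightarrow> 0"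
      by (rule Lim_null_comparison[OF always_eventually[OF allI], rotated])
    then show ?thesis using L(2)[OF linfty_translate[OF grp f g] f] True by (simp only:)
  next
    case False
    then have hT: "h \<in> T" and hG: "h \<in> carrier G" using h T by auto
    have "A (\<lambda>x. f (h \<otimes>\<^bsub>G\<^esub> x)) n = A f n" for n
    proof -
      note fn = linfty_translate[OF grp f gn[of n]]
      have "M (\<lambda>x. f (h \<otimes>\<^bsub>G\<^esub> (g [^]\<^bsub>G\<^esub> n \<otimes>\<^bsub>G\<^esub> x))) = M (\<lambda>x. f (g [^]\<^bsub>G\<^esub> n \<otimes>\<^bsub>G\<^esub> (h \<otimes>\<^bsub>G\<^esub> x)))"
      proof (intro fa_mean_cong[OF M])
        show "(\<lambda>x. f (h \<otimes>\<^bsub>G\<^esub> (g [^]\<^bsub>G\<^esub> n \<otimes>\<^bsub>G\<^esub> x))) \<in> linfty G"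
          using linfty_translate[OF grp linfty_translate[OF grp f hG] gn] .
        show "(\<lambda>x. f (g [^]\<^bsub>G\<^esub> n \<otimes>\<^bsub>G\<^esub> (h \<otimes>\<^bsub>G\<^esub> x))) \<in> linfty G" using linfty_translate[OF grp fn hG] .
      qed (use hG gn in \<open>simp_all add: m_lcomm\<close>)
      then show ?thesis using MT[OF fn hT] by (simp add: A_def)
    qed
    then have "M' N (\<lambda>x. f (h \<otimes>\<^bsub>G\<^esub> x)) = M' N f" for N by (simp add: M'_def)
    then show ?thesis using L(2)[OF linfty_translate[OF grp f hG] f] by simp
  qed
  with L(1) show ?case by blast
qed

lemma comm_group_amenable:
  assumes "comm_group G" "finitely_generated G"
  shows "amenable G"
proof -
  obtain S where S: "finite S" "S \<subseteq> carrier G" "generate G S = carrier G"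
    using assms(2) by (auto simp: finitely_generated_def)
  obtain M where M: "fa_mean G M" "\<forall>f\<in>linfty G. \<forall>g\<in>S. M (\<lambda>x. f (g \<otimes>\<^bsub>G\<^esub> x)) = M f"
    using comm_group_invariant_mean[OF assms(1) S(1,2)] by (elim exE conjE)
  show ?thesis
    by (rule amenableI[OF comm_group.axioms(2)[OF assms(1)] M(1) S(2,3)]) (simp add: M(2))
qed

subsection \<open>Characters and the spectral radius\<close>

text \<open>The total mass is left free so that probability measures, their pushforwards and the
  rescaled exponential twists are all covered.\<close>

locale group_measure = group G for G :: "('a, 'b) monoid_scheme" (structure) +
  fixes \<mu> :: "'a \<Rightarrow> real"
  assumes nonneg: "g \<in> carrier G \<Longrightarrow> 0 \<le> \<mu> g"
    and summable: "\<mu> summable_on carrier G"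
begin

lemma summable_mult_bounded:
  assumes "\<And>x. x \<in> carrier G \<Longrightarrow> 0 \<le> f x \<and> f x \<le> C" "x \<in> carrier G"
  shows "(\<lambda>s. \<mu> s * f (inv s \<otimes> x)) summable_on carrier G"
proof (rule summable_on_comparison_test)
  show "(\<lambda>s. \<mu> s * C) summable_on carrier G"
    using summable by (rule summable_on_cmult_left)
  fix s assume s: "s \<in> carrier G"
  then have "0 \<le> f (inv s \<otimes> x) \<and> f (inv s \<otimes> x) \<le> C" using assms by simp
  then show "\<mu> s * f (inv s \<otimes> x) \<le> \<mu> s * C" "0 \<le> \<mu> s * f (inv s \<otimes> x)"
    using nonneg[OF s] by (simp_all add: mult_left_mono)
qed

lemma conv_power_nonneg: "x \<in> carrier G \<Longrightarrow> 0 \<le> conv_power G \<mu> n x"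
proof (induction n arbitrary: x)
  case (Suc n)
  then show ?case
    using nonneg by (simp add: convolution_def) (intro infsum_nonneg mult_nonneg_nonneg, auto)
qed simp

text \<open>Since \<open>infsum\<close> is 0 on divergent families, every convolution has to be
  known to converge. A bounded power against the summable \<open>\<mu>\<close> gives this.\<close>

lemma conv_power_bounded: "\<exists>C. \<forall>x\<in>carrier G. conv_power G \<mu> n x \<le> C"
proof (induction n)
  case 0
  show ?case by (intro exI[of _ 1]) simp
next
  case (Suc n)
  then obtain C where C: "\<And>x. x \<in> carrier G \<Longrightarrow> conv_power G \<mu> n x \<le> C" by blast
  have "conv_power G \<mu> (Suc n) x \<le> (\<Sum>\<^sub>\<infinity>s\<in>carrier G. \<mu> s * C)" if x: "x \<in> carrier G" for x
    unfolding conv_power.simps convolution_def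
  proof (rule infsum_mono)
    show "(\<lambda>s. \<mu> s * conv_power G \<mu> n (inv s \<otimes> x)) summable_on carrier G"
      using C conv_power_nonneg x by (intro summable_mult_bounded) auto
    show "(\<lambda>s. \<mu> s * C) summable_on carrier G"
      using summable by (rule summable_on_cmult_left)
    show "\<mu> s * conv_power G \<mu> n (inv s \<otimes> x) \<le> \<mu> s * C" if "s \<in> carrier G" for s
      using C nonneg that x by (simp add: mult_left_mono)
  qed
  then show ?case by blast
qed

lemma conv_power_summable:
  assumes "x \<in> carrier G"
  shows "(\<lambda>s. \<mu> s * conv_power G \<mu> n (inv s \<otimes> x)) summable_on carrier G"
proof -
  obtain C where "\<forall>x\<in>carrier G. conv_power G \<mu> n x \<le> C" using conv_power_bounded by blast
  then show ?thesis using conv_power_nonneg assms by (intro summable_mult_bounded) auto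
qed

lemma conv_power_Suc_ge:
  assumes "finite S" "S \<subseteq> carrier G" "x \<in> carrier G"
  shows "(\<Sum>s\<in>S. \<mu> s * conv_power G \<mu> n (inv s \<otimes> x)) \<le> conv_power G \<mu> (Suc n) x"
  unfolding conv_power.simps convolution_def
  by (rule finite_sum_le_infsum[OF conv_power_summable]) (use assms nonneg conv_power_nonneg in auto)

text \<open>The left side counts only the paths to \<open>x \<otimes> y\<close> that are at
  \<open>x\<close> at time \<open>m\<close>.\<close>

lemma conv_power_mult_le:
  assumes "x \<in> carrier G" "y \<in> carrier G"
  shows "conv_power G \<mu> m x * conv_power G \<mu> n y \<le> conv_power G \<mu> (m + n) (x \<otimes> y)"
  using assms(1)
proof (induction m arbitrary: x)
  case 0
  then show ?case using assms conv_power_nonneg by simp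
next
  case (Suc m)
  have "conv_power G \<mu> (Suc m) x * conv_power G \<mu> n y =
      (\<Sum>\<^sub>\<infinity>s\<in>carrier G. \<mu> s * conv_power G \<mu> m (inv s \<otimes> x) * conv_power G \<mu> n y)"
    by (simp add: convolution_def infsum_cmult_left')
  also have "\<dots> \<le> (\<Sum>\<^sub>\<infinity>s\<in>carrier G. \<mu> s * conv_power G \<mu> (m + n) (inv s \<otimes> (x \<otimes> y)))"
  proof (rule infsum_mono)
    show "(\<lambda>s. \<mu> s * conv_power G \<mu> m (inv s \<otimes> x) * conv_power G \<mu> n y) summable_on carrier G"
      using conv_power_summable[OF Suc.prems] by (rule summable_on_cmult_left)
    show "(\<lambda>s. \<mu> s * conv_power G \<mu> (m + n) (inv s \<otimes> (x \<otimes> y))) summable_on carrier G"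
      using conv_power_summable Suc.prems assms(2) by simp
    fix s assume s: "s \<in> carrier G"
    then have "conv_power G \<mu> m (inv s \<otimes> x) * conv_power G \<mu> n y
        \<le> conv_power G \<mu> (m + n) (inv s \<otimes> (x \<otimes> y))"
      using Suc.IH[of "inv s \<otimes> x"] Suc.prems assms(2) by (simp add: m_assoc)
    then show "\<mu> s * conv_power G \<mu> m (inv s \<otimes> x) * conv_power G \<mu> n y
        \<le> \<mu> s * conv_power G \<mu> (m + n) (inv s \<otimes> (x \<otimes> y))"
      using nonneg[OF s] by (simp add: mult.assoc mult_left_mono)
  qed
  also have "\<dots> = conv_power G \<mu> (Suc m + n) (x \<otimes> y)" by (simp add: convolution_def)
  finally show ?case .
qed

lemma conv_power_1:
  assumes "x \<in> carrier G"
  shows "\<mu> x \<le> conv_power G \<mu> 1 x"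
  using conv_power_Suc_ge[of "{x}" x 0] assms by simp

text \<open>A word for \<open>x\<close> in the support is a path of positive weight, and
  \<open>m\<close> is its length. Asking for \<open>m > 0\<close> excludes the empty path at the
  identity, which says nothing about growth rates.\<close>

lemma conv_power_pos:
  assumes "nondegenerate G \<mu>" "x \<in> carrier G"
  shows "\<exists>m>0. 0 < conv_power G \<mu> m x"
proof -
  have "x \<in> semigroup_generate G (measure_support G \<mu>)"
    using assms by (simp add: nondegenerate_def)
  then have "x \<in> carrier G \<and> (\<exists>m>0. 0 < conv_power G \<mu> m x)"
  proof induction
    case (incl s)
    then show ?case
      using conv_power_1[of s] by (auto simp: measure_support_def intro!: exI[of _ 1])
  next
    case (mult x y)
    then obtain m n where "m > 0" "0 < conv_power G \<mu> m x" "0 < conv_power G \<mu> n y" by blast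
    then have "m + n > 0" "0 < conv_power G \<mu> (m + n) (x \<otimes> y)"
      using conv_power_mult_le[of x y m n] mult.IH by (auto intro: less_le_trans[OF mult_pos_pos])
    then show ?case using mult.IH by blast
  qed
  then show ?thesis by blast
qed

end

section \<open>Additive characters and upper bounds for the spectral radius\<close>

definition additive_character :: "('a, 'b) monoid_scheme \<Rightarrow> ('a \<Rightarrow> real) \<Rightarrow> bool" where
  "additive_character G \<xi> \<longleftrightarrow>
     (\<forall>x\<in>carrier G. \<forall>y\<in>carrier G. \<xi> (x \<otimes>\<^bsub>G\<^esub> y) = \<xi> x + \<xi> y)"

text \<open>Bounds the finite partial sums, since \<open>infsum\<close> takes the junk value 0 when the Laplace
  transform diverges.\<close>

definition laplace_le :: "('a, 'b) monoid_scheme \<Rightarrow> ('a \<Rightarrow> real) \<Rightarrow> ('a \<Rightarrow> real) \<Rightarrow> real \<Rightarrow> bool" where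
  "laplace_le G \<mu> \<xi> r \<longleftrightarrow>
     (\<forall>F. finite F \<and> F \<subseteq> carrier G \<longrightarrow> (\<Sum>s\<in>F. \<mu> s * exp (\<xi> s)) \<le> r)"

lemma (in group) additive_character_one: "additive_character G \<xi> \<Longrightarrow> \<xi> \<one> = 0"
  unfolding additive_character_def by (metis add_cancel_right_left one_closed r_one)

lemma (in group) additive_character_inv:
  assumes "additive_character G \<xi>" "x \<in> carrier G"
  shows "\<xi> (inv x) = - \<xi> x"
  using assms additive_character_one[OF assms(1)] unfolding additive_character_def
  by (metis add_eq_0_iff inv_closed r_inv)

text \<open>The n-th roots of \<open>C\<close> and of \<open>n\<close> tend to 1. The linear factor
  leaves room for the central binomial coefficient lost in
  \<open>exists_almost_invariant\<close>.\<close>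

lemma spectral_radius_le:
  assumes "\<And>n. n > 0 \<Longrightarrow> conv_power G \<mu> n \<one>\<^bsub>G\<^esub> \<le> C * real n * r ^ n" "0 \<le> r" "0 < C"
  shows "spectral_radius G \<mu> \<le> ereal r"
proof -
  have "limsup (\<lambda>n. ereal (root n (conv_power G \<mu> n \<one>\<^bsub>G\<^esub>))) \<le>
      limsup (\<lambda>n. ereal (root n C * root n (real n) * r))"
  proof (rule Limsup_mono, rule eventually_mono[OF eventually_gt_at_top[of 0]])
    fix n :: nat assume n: "0 < n"
    have "root n (conv_power G \<mu> n \<one>\<^bsub>G\<^esub>) \<le> root n (C * real n * r ^ n)"
      using assms(1)[OF n] n by simp
    also have "\<dots> = root n C * root n (real n) * r"
      using n assms(2) by (simp add: real_root_mult real_root_power_cancel)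
    finally show "ereal (root n (conv_power G \<mu> n \<one>\<^bsub>G\<^esub>)) \<le> ereal (root n C * root n (real n) * r)"
      by simp
  qed
  also have "(\<lambda>n. root n C * root n (real n) * r) \<longlonglongrightarrow> 1 * 1 * r"
    using assms(3) by (intro tendsto_intros LIMSEQ_root LIMSEQ_root_const)
  then have "limsup (\<lambda>n. ereal (root n C * root n (real n) * r)) = ereal r"
    by (intro lim_imp_Limsup) simp_all
  finally show ?thesis by (simp add: spectral_radius_def)
qed

context group_measure
begin

lemma laplace_le_summable:
  assumes "laplace_le G \<mu> \<xi> r"
  shows "(\<lambda>s. \<mu> s * exp (\<xi> s)) summable_on carrier G"
    and "(\<Sum>\<^sub>\<infinity>s\<in>carrier G. \<mu> s * exp (\<xi> s)) \<le> r"
proof -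
  show *: "(\<lambda>s. \<mu> s * exp (\<xi> s)) summable_on carrier G"
  proof (rule nonneg_bdd_above_summable_on)
    show "bdd_above (sum (\<lambda>s. \<mu> s * exp (\<xi> s)) ` {F. F \<subseteq> carrier G \<and> finite F})"
      using assms by (auto simp: laplace_le_def bdd_above_def)
  qed (simp add: nonneg)
  show "(\<Sum>\<^sub>\<infinity>s\<in>carrier G. \<mu> s * exp (\<xi> s)) \<le> r"
    by (rule infsum_le_finite_sums[OF *]) (use assms in \<open>simp add: laplace_le_def\<close>)
qed

lemma laplace_le_nonneg: "laplace_le G \<mu> \<xi> r \<Longrightarrow> 0 \<le> r"
  by (force simp: laplace_le_def)

text \<open>By additivity the weight \<open>exp (\<xi> x)\<close> is distributed over the steps of a
  path, so the left side is the n-th convolution power of a measure of mass at most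
  \<open>r\<close>.\<close>

lemma conv_power_character_le:
  assumes "additive_character G \<xi>" "laplace_le G \<mu> \<xi> r" "x \<in> carrier G"
  shows "conv_power G \<mu> n x * exp (\<xi> x) \<le> r ^ n"
  using assms(3)
proof (induction n arbitrary: x)
  case 0
  then show ?case using additive_character_one[OF assms(1)] by simp
next
  case (Suc n)
  have r: "0 \<le> r ^ n" using laplace_le_nonneg[OF assms(2)] by simp
  have "conv_power G \<mu> (Suc n) x * exp (\<xi> x) =
      (\<Sum>\<^sub>\<infinity>s\<in>carrier G. \<mu> s * conv_power G \<mu> n (inv s \<otimes> x) * exp (\<xi> x))"
    by (simp add: convolution_def infsum_cmult_left')
  also have "\<dots> \<le> (\<Sum>\<^sub>\<infinity>s\<in>carrier G. \<mu> s * exp (\<xi> s) * r ^ n)"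
  proof (rule infsum_mono)
    show "(\<lambda>s. \<mu> s * conv_power G \<mu> n (inv s \<otimes> x) * exp (\<xi> x)) summable_on carrier G"
      using conv_power_summable[OF Suc.prems] by (rule summable_on_cmult_left)
    show "(\<lambda>s. \<mu> s * exp (\<xi> s) * r ^ n) summable_on carrier G"
      using laplace_le_summable(1)[OF assms(2)] by (rule summable_on_cmult_left)
    fix s assume s: "s \<in> carrier G"
    have sx: "inv s \<otimes> x \<in> carrier G" using s Suc.prems by simp
    have "\<xi> x = \<xi> (s \<otimes> (inv s \<otimes> x))" using s Suc.prems by (simp add: m_assoc[symmetric])
    also have "\<dots> = \<xi> s + \<xi> (inv s \<otimes> x)"
      using assms(1) s sx by (simp add: additive_character_def)
    finally have "\<mu> s * conv_power G \<mu> n (inv s \<otimes> x) * exp (\<xi> x) =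
        \<mu> s * exp (\<xi> s) * (conv_power G \<mu> n (inv s \<otimes> x) * exp (\<xi> (inv s \<otimes> x)))"
      by (simp add: exp_add)
    also have "\<dots> \<le> \<mu> s * exp (\<xi> s) * r ^ n"
      using Suc.IH[OF sx] nonneg[OF s] by (simp add: mult_left_mono)
    finally show "\<mu> s * conv_power G \<mu> n (inv s \<otimes> x) * exp (\<xi> x) \<le> \<mu> s * exp (\<xi> s) * r ^ n" .
  qed
  also have "\<dots> = (\<Sum>\<^sub>\<infinity>s\<in>carrier G. \<mu> s * exp (\<xi> s)) * r ^ n"
    by (simp add: infsum_cmult_left')
  also have "\<dots> \<le> r * r ^ n"
    using laplace_le_summable(2)[OF assms(2)] r by (rule mult_right_mono)
  finally show ?case by simp
qed

lemma spectral_radius_le_laplace: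
  assumes "additive_character G \<xi>" "laplace_le G \<mu> \<xi> r"
  shows "spectral_radius G \<mu> \<le> ereal r"
proof (rule spectral_radius_le[of _ _ 1])
  show "conv_power G \<mu> n \<one> \<le> 1 * real n * r ^ n" if "n > 0" for n
  proof -
    have "conv_power G \<mu> n \<one> \<le> 1 * r ^ n"
      using conv_power_character_le[OF assms one_closed, of n] additive_character_one[OF assms(1)]
      by simp
    also have "\<dots> \<le> real n * r ^ n"
      using that laplace_le_nonneg[OF assms(2)] by (intro mult_right_mono) auto
    finally show ?thesis by simp
  qed
qed (use laplace_le_nonneg[OF assms(2)] in auto)

lemma spectral_radius_nonneg: "0 \<le> spectral_radius G \<mu>"
proof -
  have "limsup (\<lambda>n. 0) \<le> limsup (\<lambda>n. ereal (root n (conv_power G \<mu> n \<one>)))"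
    using conv_power_nonneg[OF one_closed]
    by (intro Limsup_mono always_eventually) (simp add: real_root_ge_zero)
  then show ?thesis by (simp add: spectral_radius_def Limsup_const)
qed

section \<open>The Green function\<close>

lemma green_summable_one:
  assumes "spectral_radius G \<mu> < ereal r"
  shows "summable (\<lambda>n. (1 / r) ^ n * conv_power G \<mu> n \<one>)"
proof -
  obtain q' where q': "spectral_radius G \<mu> < q'" "q' < ereal r" using assms dense by blast
  then obtain q where q: "q' = ereal q" using spectral_radius_nonneg by (cases q') auto
  have "0 \<le> q" "q < r" using q' q spectral_radius_nonneg
    by (auto simp: zero_ereal_def dest: le_less_trans)
  have ev: "eventually (\<lambda>n. ereal (root n (conv_power G \<mu> n \<one>)) < ereal q) sequentially"
    using q' q unfolding spectral_radius_def by (intro Limsup_lessD) simp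
  have "eventually (\<lambda>n. norm ((1 / r) ^ n * conv_power G \<mu> n \<one>) \<le> (q / r) ^ n) sequentially"
    using ev eventually_gt_at_top[of 0]
  proof eventually_elim
    case (elim n)
    have "conv_power G \<mu> n \<one> = root n (conv_power G \<mu> n \<one>) ^ n"
      using elim conv_power_nonneg[OF one_closed] by (simp add: real_root_pow_pos2)
    also have "\<dots> \<le> q ^ n"
      using elim conv_power_nonneg[OF one_closed] by (intro power_mono real_root_ge_zero) auto
    finally have "conv_power G \<mu> n \<one> \<le> q ^ n" .
    then have "(1 / r) ^ n * conv_power G \<mu> n \<one> \<le> (1 / r) ^ n * q ^ n"
      using \<open>0 \<le> q\<close> \<open>q < r\<close> by (intro mult_left_mono) auto
    then show ?case
      using \<open>0 \<le> q\<close> \<open>q < r\<close> conv_power_nonneg[OF one_closed] by (simp add: power_divide)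
  qed
  moreover have "summable (\<lambda>n. (q / r) ^ n)"
    using \<open>0 \<le> q\<close> \<open>q < r\<close> by (intro summable_geometric) auto
  ultimately show ?thesis by (rule summable_comparison_test_ev)
qed

lemma spectral_radius_less_pos: "spectral_radius G \<mu> < ereal r \<Longrightarrow> 0 < r"
  using spectral_radius_nonneg by (auto simp: zero_ereal_def dest: le_less_trans)

text \<open>A path of length \<open>m\<close> and positive weight back from \<open>x\<close> turns
  an arrival at \<open>x\<close> into a return to the identity \<open>m\<close> steps later, so the
  series is dominated by a multiple of a tail of the return series.\<close>

lemma green_summable:
  assumes "nondegenerate G \<mu>" "spectral_radius G \<mu> < ereal r" "x \<in> carrier G"
  shows "summable (\<lambda>n. (1 / r) ^ n * conv_power G \<mu> n x)"
proof -
  have r: "0 < r" using assms(2) by (rule spectral_radius_less_pos)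
  obtain m where m: "0 < conv_power G \<mu> m (inv x)" (is "0 < ?c")
    using conv_power_pos[OF assms(1), of "inv x"] assms(3) by auto
  have "summable (\<lambda>n. (r ^ m / ?c) * ((1 / r) ^ (n + m) * conv_power G \<mu> (n + m) \<one>))"
    using green_summable_one[OF assms(2)]
    by (intro summable_mult) (subst summable_iff_shift)
  then show ?thesis
  proof (rule summable_comparison_test')
    fix n :: nat
    have "conv_power G \<mu> n x * ?c \<le> conv_power G \<mu> (n + m) \<one>"
      using conv_power_mult_le[of x "inv x" n m] assms(3) by simp
    then have "conv_power G \<mu> n x \<le> conv_power G \<mu> (n + m) \<one> / ?c" using m by (simp add: field_simps)
    then have "(1 / r) ^ n * conv_power G \<mu> n x \<le> (1 / r) ^ n * (conv_power G \<mu> (n + m) \<one> / ?c)"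
      using r by (intro mult_left_mono) auto
    also have "\<dots> = (r ^ m / ?c) * ((1 / r) ^ (n + m) * conv_power G \<mu> (n + m) \<one>)"
      using r by (simp add: power_add power_divide)
    finally show "norm ((1 / r) ^ n * conv_power G \<mu> n x)
        \<le> (r ^ m / ?c) * ((1 / r) ^ (n + m) * conv_power G \<mu> (n + m) \<one>)"
      using r conv_power_nonneg[OF assms(3)] by simp
  qed
qed

text \<open>Translation by \<open>g\<close> changes the logarithm of the Green function \<open>F\<close> by a bounded amount
  (Harnack), so the mean of this change is defined; by invariance it is additive in \<open>g\<close>. The bound
  comes from \<open>r * F x \<ge> (\<Sum>s\<in>S. \<mu> s * F (inv s \<otimes> x))\<close> and Jensen's inequality.\<close>

lemma amenable_imp_character:
  assumes amen: "amenable G" and nd: "nondegenerate G \<mu>" and r: "spectral_radius G \<mu> < ereal r"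
  shows "\<exists>\<xi>. additive_character G \<xi> \<and> laplace_le G \<mu> \<xi> r"
proof -
  have r0: "0 < r" using r by (rule spectral_radius_less_pos)
  have ne: "carrier G \<noteq> {}" using one_closed by blast
  from amen obtain M where M: "fa_mean G M"
    and inv: "\<And>f g. f \<in> linfty G \<Longrightarrow> g \<in> carrier G \<Longrightarrow> M (\<lambda>x. f (g \<otimes> x)) = M f"
    unfolding amenable_def banach_mean_iff[OF ne] by blast
  define T where "T n x = (1 / r) ^ n * conv_power G \<mu> n x" for n x
  define F where "F x = (\<Sum>n. T n x)" for x
  have T_sum: "summable (\<lambda>n. T n x)" if "x \<in> carrier G" for x
    unfolding T_def using nd r that by (rule green_summable)
  have T_nonneg: "0 \<le> T n x" if "x \<in> carrier G" for n x
    using that r0 conv_power_nonneg by (simp add: T_def)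
  have T_shift: "(\<Sum>n. T (n + m) x) \<le> F x" if "x \<in> carrier G" for x m
    using suminf_split_initial_segment[OF T_sum[OF that], of m] T_nonneg[OF that]
    by (simp add: F_def sum_nonneg)
  have T_sum': "summable (\<lambda>n. T (n + m) x)" if "x \<in> carrier G" for x m
    using T_sum[OF that] by (subst summable_iff_shift)
  have F_pos: "0 < F x" if x: "x \<in> carrier G" for x
  proof -
    obtain m where "0 < conv_power G \<mu> m x" using conv_power_pos[OF nd x] by blast
    then have "0 < T m x" using r0 by (simp add: T_def)
    then show ?thesis unfolding F_def using T_sum[OF x] T_nonneg[OF x] by (intro suminf_pos2)
  qed
  \<comment> \<open>Prefixing one fixed path to \<open>g\<close> turns paths to \<open>x\<close>
    into paths to \<open>g \<otimes> x\<close>; its weight \<open>T m g\<close> is a constant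
    independent of \<open>x\<close>.\<close>
  have harnack: "\<exists>c>0. \<forall>x\<in>carrier G. c * F x \<le> F (g \<otimes> x)" if g: "g \<in> carrier G" for g
  proof -
    obtain m where m: "0 < conv_power G \<mu> m g" using conv_power_pos[OF nd g] by blast
    have "T m g * F x \<le> F (g \<otimes> x)" if x: "x \<in> carrier G" for x
    proof -
      have "T m g * F x = (\<Sum>n. T m g * T n x)"
        unfolding F_def using T_sum[OF x] by (simp add: suminf_mult)
      also have "\<dots> \<le> (\<Sum>n. T (n + m) (g \<otimes> x))"
      proof (rule suminf_le)
        show "T m g * T n x \<le> T (n + m) (g \<otimes> x)" for n
          using mult_left_mono[OF conv_power_mult_le[OF g x, of m n], of "(1 / r) ^ (m + n)"] r0
          by (simp add: T_def power_add ac_simps)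
      qed (use g x T_sum' T_sum in \<open>auto intro: summable_mult\<close>)
      also have "\<dots> \<le> F (g \<otimes> x)" using g x by (intro T_shift) simp
      finally show ?thesis .
    qed
    moreover have "0 < T m g" using m r0 by (simp add: T_def)
    ultimately show ?thesis by blast
  qed
  \<comment> \<open>A first step \<open>s\<close> raises the index by one, which accounts for the
    factor \<open>r\<close>; the dropped term of index 0 makes this an inequality. With
    \<open>S\<close> finite, no two infinite sums have to be interchanged.\<close>
  have step: "(\<Sum>s\<in>S. \<mu> s * F (inv s \<otimes> x)) \<le> r * F x"
    if S: "finite S" "S \<subseteq> carrier G" and x: "x \<in> carrier G" for S x
  proof -
    have sx: "inv s \<otimes> x \<in> carrier G" if "s \<in> S" for s using S x that by auto
    have "(\<lambda>n. \<mu> s * T n (inv s \<otimes> x)) sums (\<mu> s * F (inv s \<otimes> x))" if "s \<in> S" for s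
      unfolding F_def using T_sum[OF sx[OF that]] by (intro sums_mult summable_sums)
    then have sums: "(\<lambda>n. \<Sum>s\<in>S. \<mu> s * T n (inv s \<otimes> x)) sums (\<Sum>s\<in>S. \<mu> s * F (inv s \<otimes> x))"
      by (rule sums_sum)
    have "(\<Sum>s\<in>S. \<mu> s * F (inv s \<otimes> x)) \<le> (\<Sum>n. r * T (n + 1) x)"
      unfolding sums_unique[OF sums]
    proof (rule suminf_le)
      show "(\<Sum>s\<in>S. \<mu> s * T n (inv s \<otimes> x)) \<le> r * T (n + 1) x" for n
      proof -
        have "(\<Sum>s\<in>S. \<mu> s * T n (inv s \<otimes> x)) =
            (1 / r) ^ n * (\<Sum>s\<in>S. \<mu> s * conv_power G \<mu> n (inv s \<otimes> x))"
          by (simp add: T_def sum_distrib_left ac_simps)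
        also have "\<dots> \<le> (1 / r) ^ n * conv_power G \<mu> (Suc n) x"
          using r0 by (intro mult_left_mono conv_power_Suc_ge S x) auto
        also have "\<dots> = r * T (n + 1) x" using r0 by (simp add: T_def)
        finally show ?thesis .
      qed
    qed (use sums x T_sum'[of x 1] in \<open>auto simp: sums_iff intro: summable_mult\<close>)
    also have "\<dots> = r * (\<Sum>n. T (n + 1) x)" using T_sum'[OF x] by (rule suminf_mult)
    also have "\<dots> \<le> r * F x" using r0 by (intro mult_left_mono T_shift[OF x]) simp
    finally show ?thesis .
  qed
  define u where "u g x = ln (F (g \<otimes> x)) - ln (F x)" for g x
  have u_bdd: "u g \<in> linfty G" if g: "g \<in> carrier G" for g
  proof -
    obtain c where c: "c > 0" "\<And>x. x \<in> carrier G \<Longrightarrow> c * F x \<le> F (g \<otimes> x)"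
      using harnack[OF g] by blast
    obtain d where d: "d > 0" "\<And>x. x \<in> carrier G \<Longrightarrow> d * F x \<le> F (inv g \<otimes> x)"
      using harnack[of "inv g"] g by auto
    show ?thesis
    proof (rule linftyI[of G _ "\<bar>ln c\<bar> + \<bar>ln d\<bar>"])
      fix x assume x: "x \<in> carrier G"
      have gx: "g \<otimes> x \<in> carrier G" using g x by simp
      have "ln c + ln (F x) \<le> ln (F (g \<otimes> x))"
        using c(1) c(2)[OF x] F_pos[OF x] F_pos[OF gx] by (simp flip: ln_mult_pos)
      moreover have "d * F (g \<otimes> x) \<le> F x"
        using d(2)[OF gx] g x by (simp add: m_assoc[symmetric])
      then have "ln d + ln (F (g \<otimes> x)) \<le> ln (F x)"
        using d(1) F_pos[OF x] F_pos[OF gx] by (simp flip: ln_mult_pos)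
      ultimately show "\<bar>u g x\<bar> \<le> \<bar>ln c\<bar> + \<bar>ln d\<bar>" unfolding u_def by linarith
    qed
  qed
  \<comment> \<open>With this sign \<open>M (u (inv s)) = \<xi> s\<close>, which fits the translates
    \<open>inv s \<otimes> x\<close> in the convolution.\<close>
  define \<xi> where "\<xi> g = - M (u g)" for g
  have char: "additive_character G \<xi>"
    unfolding additive_character_def
  proof (intro ballI)
    fix g h assume g: "g \<in> carrier G" and h: "h \<in> carrier G"
    have gh: "g \<otimes> h \<in> carrier G" using g h by simp
    note tr = linfty_translate[OF is_group u_bdd[OF g] h]
    \<comment> \<open>\<open>u\<close> is an additive cocycle, and the invariance of
      \<open>M\<close> removes the translation by \<open>h\<close> from its first term.\<close>
    have "M (u (g \<otimes> h)) = M (\<lambda>x. u g (h \<otimes> x) + u h x)"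
      by (rule fa_mean_cong[OF M u_bdd[OF gh] linfty_add[OF tr u_bdd[OF h]]])
        (simp add: u_def g h m_assoc)
    also have "\<dots> = M (\<lambda>x. u g (h \<otimes> x)) + M (u h)" by (rule fa_mean_add[OF M tr u_bdd[OF h]])
    also have "M (\<lambda>x. u g (h \<otimes> x)) = M (u g)" by (rule inv[OF u_bdd[OF g] h])
    finally show "\<xi> (g \<otimes> h) = \<xi> g + \<xi> h" by (simp add: \<xi>_def)
  qed
  have "laplace_le G \<mu> \<xi> r"
    unfolding laplace_le_def
  proof (intro allI impI, elim conjE)
    fix S assume S: "finite S" "S \<subseteq> carrier G"
    \<comment> \<open>Jensen's inequality by a tangent: \<open>w s x\<close> is
      \<open>\<mu> s\<close> times the tangent line of \<open>exp\<close> at \<open>\<xi> s\<close>,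
      evaluated at \<open>u (inv s) x\<close>. It lies below the exponential, and its mean is its
      value at the point of tangency.\<close>
    define w where "w s x = \<mu> s * exp (\<xi> s) * (1 + (u (inv s) x - \<xi> s))" for s x
    have s: "inv s \<in> carrier G" "s \<in> carrier G" if "s \<in> S" for s using S that by auto
    have w_bdd: "w s \<in> linfty G" and Mw: "M (w s) = \<mu> s * exp (\<xi> s)" if "s \<in> S" for s
    proof -
      have w_eq: "w s = (\<lambda>x. (\<mu> s * exp (\<xi> s)) * (u (inv s) x + (1 - \<xi> s)))"
        by (simp add: w_def fun_eq_iff)
      note l = linfty_add[OF u_bdd[OF s(1)[OF that]] linfty_const[of "1 - \<xi> s"]]
      show "w s \<in> linfty G" unfolding w_eq by (rule linfty_cmult[OF l])
      have "M (w s) = (\<mu> s * exp (\<xi> s)) * (M (u (inv s)) + M (\<lambda>x. 1 - \<xi> s))"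
        unfolding w_eq fa_mean_cmult[OF M l]
        unfolding fa_mean_add[OF M u_bdd[OF s(1)[OF that]] linfty_const[of "1 - \<xi> s"]] ..
      also have "M (u (inv s)) = \<xi> s"
        using additive_character_inv[OF char s(2)[OF that]] by (simp add: \<xi>_def)
      finally show "M (w s) = \<mu> s * exp (\<xi> s)" by (simp add: fa_mean_const[OF M])
    qed
    have "(\<Sum>s\<in>S. \<mu> s * exp (\<xi> s)) = M (\<lambda>x. \<Sum>s\<in>S. w s x)"
      using fa_mean_sum[OF M S(1), of w] w_bdd Mw by simp
    also have "\<dots> \<le> r"
    proof (rule fa_mean_upper[OF M])
      show "(\<lambda>x. \<Sum>s\<in>S. w s x) \<in> linfty G"
        using fa_mean_sum[OF M S(1), of w] w_bdd by blast
      fix x assume x: "x \<in> carrier G"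
      have "w s x \<le> \<mu> s * F (inv s \<otimes> x) / F x" if sS: "s \<in> S" for s
      proof -
        have sx: "inv s \<otimes> x \<in> carrier G" using s[OF sS] x by simp
        have "exp (\<xi> s) * (1 + (u (inv s) x - \<xi> s)) \<le> exp (\<xi> s) * exp (u (inv s) x - \<xi> s)"
          by (intro mult_left_mono exp_ge_add_one_self) simp
        also have "\<dots> = exp (u (inv s) x)" by (simp flip: exp_add)
        also have "\<dots> = F (inv s \<otimes> x) / F x"
          using F_pos[OF x] F_pos[OF sx] by (simp add: u_def exp_diff)
        finally show ?thesis
          using mult_left_mono[OF _ nonneg[OF s(2)[OF sS]]] by (fastforce simp: w_def mult.assoc)
      qed
      then have "(\<Sum>s\<in>S. w s x) \<le> (\<Sum>s\<in>S. \<mu> s * F (inv s \<otimes> x) / F x)" by (rule sum_mono)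
      also have "\<dots> = (\<Sum>s\<in>S. \<mu> s * F (inv s \<otimes> x)) / F x" by (simp add: sum_divide_distrib)
      also have "\<dots> \<le> r" using step[OF S x] F_pos[OF x] by (simp add: field_simps)
      finally show "(\<Sum>s\<in>S. w s x) \<le> r" .
    qed
    finally show "(\<Sum>s\<in>S. \<mu> s * exp (\<xi> s)) \<le> r" .
  qed
  with char show ?thesis by blast
qed

end

subsection \<open>Almost invariant vectors\<close>

lemma (in group) has_sum_translate:
  assumes "g \<in> carrier G" "(h has_sum S) (carrier G)"
  shows "((\<lambda>x. h (g \<otimes> x)) has_sum S) (carrier G)"
proof -
  have "bij_betw (\<lambda>x. g \<otimes> x) (carrier G) (carrier G)"
    by (rule bij_betwI[of _ _ _ "\<lambda>x. inv g \<otimes> x"]) (use assms(1) in \<open>auto simp: m_assoc[symmetric]\<close>)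
  from has_sum_reindex_bij_betw[OF this, of h S] show ?thesis using assms(2) by simp
qed

context group
begin

text \<open>The range restriction keeps convolutions of such functions summable.\<close>

definition square_summable :: "('a \<Rightarrow> real) \<Rightarrow> bool" where
  "square_summable f \<longleftrightarrow>
     (\<forall>x\<in>carrier G. 0 \<le> f x \<and> f x \<le> 1) \<and> (\<lambda>x. (f x)\<^sup>2) summable_on carrier G"

definition normsq :: "('a \<Rightarrow> real) \<Rightarrow> real" where
  "normsq f = (\<Sum>\<^sub>\<infinity>x\<in>carrier G. (f x)\<^sup>2)"

lemma square_summable_translate:
  assumes "square_summable f" "g \<in> carrier G"
  shows "((\<lambda>x. (f (g \<otimes> x))\<^sup>2) has_sum normsq f) (carrier G)"
  using assms by (intro has_sum_translate) (simp_all add: square_summable_def normsq_def)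

lemma square_summable_diff:
  assumes f: "square_summable f" and g: "g \<in> carrier G"
  shows "(\<lambda>x. (f x - f (g \<otimes> x))\<^sup>2) summable_on carrier G"
proof (rule summable_on_comparison_test)
  show "(\<lambda>x. 2 * (f x)\<^sup>2 + 2 * (f (g \<otimes> x))\<^sup>2) summable_on carrier G"
    using f has_sum_imp_summable[OF square_summable_translate[OF f g]]
    by (intro summable_on_add summable_on_cmult_right) (auto simp: square_summable_def)
  show "(f x - f (g \<otimes> x))\<^sup>2 \<le> 2 * (f x)\<^sup>2 + 2 * (f (g \<otimes> x))\<^sup>2" for x
    using sum_squares_ge_zero[of "f x + f (g \<otimes> x)" 0] by (simp add: power2_eq_square algebra_simps)
qed simp

lemma square_summable_mult:
  assumes f: "square_summable f" and h: "h \<in> linfty G"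
  shows "(\<lambda>x. (f x)\<^sup>2 * h x) summable_on carrier G"
proof -
  obtain c where c: "\<forall>x\<in>carrier G. \<bar>h x\<bar> \<le> c" using linfty_bound[OF h] by blast
  have "(\<lambda>x. norm ((f x)\<^sup>2 * h x)) summable_on carrier G"
  proof (rule Infinite_Sum.abs_summable_on_comparison_test')
    show "(\<lambda>x. (f x)\<^sup>2 * c) summable_on carrier G"
      using f by (intro summable_on_cmult_left) (simp add: square_summable_def)
    show "norm ((f x)\<^sup>2 * h x) \<le> (f x)\<^sup>2 * c" if "x \<in> carrier G" for x
      using c that by (simp add: abs_mult mult_left_mono)
  qed
  then show ?thesis by (rule Infinite_Sum.abs_summable_summable)
qed

text \<open>The quotient of \<open>f\<close> squared by \<open>normsq f\<close> is a probability
  density on the group.\<close>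

lemma fa_mean_square_summable:
  assumes f: "square_summable f" "0 < normsq f"
  shows "fa_mean G (\<lambda>h. (\<Sum>\<^sub>\<infinity>x\<in>carrier G. (f x)\<^sup>2 * h x) / normsq f)"
  unfolding fa_mean_def
proof (intro conjI ballI allI impI)
  fix h k assume "h \<in> linfty G" "k \<in> linfty G"
  then have "(\<Sum>\<^sub>\<infinity>x\<in>carrier G. (f x)\<^sup>2 * h x + (f x)\<^sup>2 * k x) =
      (\<Sum>\<^sub>\<infinity>x\<in>carrier G. (f x)\<^sup>2 * h x) + (\<Sum>\<^sub>\<infinity>x\<in>carrier G. (f x)\<^sup>2 * k x)"
    by (intro infsum_add square_summable_mult f)
  then show "(\<Sum>\<^sub>\<infinity>x\<in>carrier G. (f x)\<^sup>2 * (h x + k x)) / normsq f =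
      (\<Sum>\<^sub>\<infinity>x\<in>carrier G. (f x)\<^sup>2 * h x) / normsq f + (\<Sum>\<^sub>\<infinity>x\<in>carrier G. (f x)\<^sup>2 * k x) / normsq f"
    by (simp add: distrib_left add_divide_distrib)
next
  fix c :: real and h :: "'a \<Rightarrow> real"
  have "(\<Sum>\<^sub>\<infinity>x\<in>carrier G. (f x)\<^sup>2 * (c * h x)) = c * (\<Sum>\<^sub>\<infinity>x\<in>carrier G. (f x)\<^sup>2 * h x)"
    by (subst infsum_cmult_right'[symmetric]) (simp add: ac_simps)
  then show "(\<Sum>\<^sub>\<infinity>x\<in>carrier G. (f x)\<^sup>2 * (c * h x)) / normsq f =
      c * ((\<Sum>\<^sub>\<infinity>x\<in>carrier G. (f x)\<^sup>2 * h x) / normsq f)" by simp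
next
  fix h c assume h: "h \<in> linfty G" "\<forall>x\<in>carrier G. h x \<le> c"
  have "(\<Sum>\<^sub>\<infinity>x\<in>carrier G. (f x)\<^sup>2 * h x) \<le> (\<Sum>\<^sub>\<infinity>x\<in>carrier G. (f x)\<^sup>2 * c)"
    using square_summable_mult[OF f(1) h(1)] square_summable_mult[OF f(1) linfty_const]
    by (rule infsum_mono) (use h(2) in \<open>simp add: mult_left_mono\<close>)
  also have "\<dots> = normsq f * c" by (simp add: normsq_def infsum_cmult_left')
  finally show "(\<Sum>\<^sub>\<infinity>x\<in>carrier G. (f x)\<^sup>2 * h x) / normsq f \<le> c"
    using f(2) by (simp add: field_simps)
qed

text \<open>The factorisation of a difference of squares, followed by the weighted inequality
  between arithmetic and geometric mean in place of Cauchy-Schwarz. The parameter \<open>s\<close>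
  is free so that it can later be taken of the order of the relative displacement of
  \<open>f\<close>, which makes both terms small against \<open>normsq f\<close>.\<close>

lemma square_diff_bound:
  assumes f: "square_summable f" and g: "g \<in> carrier G" and h: "h \<in> linfty G"
    and c: "\<And>x. x \<in> carrier G \<Longrightarrow> \<bar>h x\<bar> \<le> c" and s: "0 < s"
  shows "\<bar>(\<Sum>\<^sub>\<infinity>x\<in>carrier G. (f x)\<^sup>2 * h (g \<otimes> x)) - (\<Sum>\<^sub>\<infinity>x\<in>carrier G. (f x)\<^sup>2 * h x)\<bar>
    \<le> c * ((\<Sum>\<^sub>\<infinity>x\<in>carrier G. (f x - f (inv g \<otimes> x))\<^sup>2) / (2 * s) + 2 * s * normsq f)"
proof -
  define D where "D = (\<Sum>\<^sub>\<infinity>x\<in>carrier G. (f x - f (inv g \<otimes> x))\<^sup>2)"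
  define I where "I = (\<Sum>\<^sub>\<infinity>x\<in>carrier G. (f x)\<^sup>2 * h (g \<otimes> x))"
  define J where "J = (\<Sum>\<^sub>\<infinity>x\<in>carrier G. (f x)\<^sup>2 * h x)"
  have ig: "inv g \<in> carrier G" using g by simp
  have D: "((\<lambda>x. (f x - f (inv g \<otimes> x))\<^sup>2) has_sum D) (carrier G)"
    unfolding D_def using square_summable_diff[OF f ig] by simp
  have N: "((\<lambda>x. (f x)\<^sup>2) has_sum normsq f) (carrier G)"
    using f by (simp add: square_summable_def normsq_def)
  \<comment> \<open>Replacing \<open>x\<close> by \<open>inv g \<otimes> x\<close> moves the
    translation from \<open>h\<close> to \<open>f\<close>.\<close>
  have I: "((\<lambda>x. (f (inv g \<otimes> x))\<^sup>2 * h x) has_sum I) (carrier G)"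
  proof -
    have "((\<lambda>x. (f x)\<^sup>2 * h (g \<otimes> x)) has_sum I) (carrier G)"
      unfolding I_def using square_summable_mult[OF f linfty_translate[OF is_group h g]] by simp
    from has_sum_translate[OF ig this] show ?thesis
      by (rule has_sum_cong[THEN iffD1, rotated]) (simp add: g m_assoc[symmetric])
  qed
  have J: "((\<lambda>x. (f x)\<^sup>2 * h x) has_sum J) (carrier G)"
    unfolding J_def using square_summable_mult[OF f h] by simp
  define B where "B x = c * ((f x - f (inv g \<otimes> x))\<^sup>2 / (2 * s) + s * ((f x)\<^sup>2 + (f (inv g \<otimes> x))\<^sup>2))" for x
  have B: "(B has_sum (c * (D / (2 * s) + s * (normsq f + normsq f)))) (carrier G)"
    unfolding B_def using D N square_summable_translate[OF f ig]
    by (intro has_sum_cmult_right has_sum_add has_sum_divide_const)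
  have IJ: "((\<lambda>x. (f (inv g \<otimes> x))\<^sup>2 * h x - (f x)\<^sup>2 * h x) has_sum (I - J)) (carrier G)"
    using has_sum_add[OF I has_sum_uminusI[OF J]] by simp
  have JI: "((\<lambda>x. (f x)\<^sup>2 * h x - (f (inv g \<otimes> x))\<^sup>2 * h x) has_sum (J - I)) (carrier G)"
    using has_sum_add[OF J has_sum_uminusI[OF I]] by simp
  have pt: "\<bar>(f (inv g \<otimes> x))\<^sup>2 * h x - (f x)\<^sup>2 * h x\<bar> \<le> B x" if x: "x \<in> carrier G" for x
  proof -
    define a b where "a = f x" and "b = f (inv g \<otimes> x)"
    have "0 \<le> (\<bar>a - b\<bar> - s * \<bar>a + b\<bar>)\<^sup>2" by simp
    then have "2 * s * (\<bar>a - b\<bar> * \<bar>a + b\<bar>) \<le> (a - b)\<^sup>2 + s\<^sup>2 * (a + b)\<^sup>2"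
      by (simp add: power2_diff power_mult_distrib algebra_simps)
    also have "(a + b)\<^sup>2 \<le> 2 * (a\<^sup>2 + b\<^sup>2)"
      using zero_le_power2[of "a - b"] by (simp add: power2_diff power2_sum)
    then have "(a - b)\<^sup>2 + s\<^sup>2 * (a + b)\<^sup>2 \<le> (a - b)\<^sup>2 + s\<^sup>2 * (2 * (a\<^sup>2 + b\<^sup>2))"
      by (intro add_left_mono mult_left_mono) auto
    finally have "\<bar>a - b\<bar> * \<bar>a + b\<bar> \<le> (a - b)\<^sup>2 / (2 * s) + s * (a\<^sup>2 + b\<^sup>2)"
      using s by (simp add: field_simps power2_eq_square)
    then have le: "\<bar>a - b\<bar> * \<bar>a + b\<bar> * c \<le> ((a - b)\<^sup>2 / (2 * s) + s * (a\<^sup>2 + b\<^sup>2)) * c"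
      using c[OF x] by (intro mult_right_mono) auto
    have "\<bar>b\<^sup>2 * h x - a\<^sup>2 * h x\<bar> = \<bar>a - b\<bar> * \<bar>a + b\<bar> * \<bar>h x\<bar>"
      by (simp add: abs_mult[symmetric] power2_eq_square algebra_simps abs_minus_commute)
    also have "\<dots> \<le> \<bar>a - b\<bar> * \<bar>a + b\<bar> * c"
      using c[OF x] by (intro mult_left_mono) auto
    also note le
    finally have "\<bar>b\<^sup>2 * h x - a\<^sup>2 * h x\<bar> \<le> ((a - b)\<^sup>2 / (2 * s) + s * (a\<^sup>2 + b\<^sup>2)) * c" .
    then show ?thesis unfolding B_def a_def b_def by (simp only: mult.commute)
  qed
  have "I - J \<le> c * (D / (2 * s) + s * (normsq f + normsq f))"
    using IJ B by (rule has_sum_mono) (use pt in \<open>auto dest: abs_le_D1\<close>)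
  moreover have "J - I \<le> c * (D / (2 * s) + s * (normsq f + normsq f))"
    using JI B by (rule has_sum_mono) (use pt in \<open>fastforce dest: abs_le_D2\<close>)
  ultimately show ?thesis unfolding D_def I_def J_def by (simp add: abs_le_iff mult_2[symmetric] ac_simps)
qed

text \<open>The means with the densities given by the squares of the \<open>f n\<close> are moved
  less and less by each generator, so a limit of them is invariant under \<open>S\<close>.\<close>

lemma almost_invariant_imp_amenable:
  assumes f: "\<And>n. square_summable (f n)" "\<And>n. 0 < normsq (f n)"
    and S: "S \<subseteq> carrier G" "generate G S = carrier G"
    and lim: "\<And>g. g \<in> S \<Longrightarrow>
      (\<lambda>n. (\<Sum>\<^sub>\<infinity>x\<in>carrier G. (f n x - f n (inv g \<otimes> x))\<^sup>2) / normsq (f n)) \<longlonglongrightarrow> 0"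
  shows "amenable G"
proof -
  define M where "M n h = (\<Sum>\<^sub>\<infinity>x\<in>carrier G. (f n x)\<^sup>2 * h x) / normsq (f n)" for n h
  have M: "fa_mean G (M n)" for n
    using fa_mean_square_summable[OF f] by (simp add: M_def[abs_def])
  obtain L where L: "fa_mean G L"
    "\<And>h k. h \<in> linfty G \<Longrightarrow> k \<in> linfty G \<Longrightarrow> (\<lambda>n. M n h - M n k) \<longlonglongrightarrow> 0 \<Longrightarrow> L h = L k"
    using fa_mean_limit[of G M, OF M] by blast
  show ?thesis
  proof (rule amenableI[OF is_group L(1) S])
    fix h g assume h: "h \<in> linfty G" and gS: "g \<in> S"
    have g: "g \<in> carrier G" using gS S by auto
    obtain c where c: "\<And>x. x \<in> carrier G \<Longrightarrow> \<bar>h x\<bar> \<le> c" using linfty_bound[OF h] by blast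
    have c0: "0 \<le> c" using c[OF one_closed] by simp
    define e where "e n = (\<Sum>\<^sub>\<infinity>x\<in>carrier G. (f n x - f n (inv g \<otimes> x))\<^sup>2) / normsq (f n)" for n
    have e0: "0 \<le> e n" for n using f(2)[of n] by (auto simp: e_def intro!: divide_nonneg_pos infsum_nonneg)
    \<comment> \<open>The root of \<open>e n\<close> balances the two terms of
      \<open>square_diff_bound\<close> up to a constant; the extra \<open>1 / real (Suc n)\<close>
      keeps \<open>s n\<close> positive when \<open>e n = 0\<close>. The terms become at most
      \<open>s n / 2\<close> and \<open>2 * s n\<close>, whence the factor
      \<open>5 / 2\<close>.\<close>
    define s where "s n = sqrt (e n + 1 / real (Suc n))" for n
    have s0: "0 < s n" for n
      using e0[of n] by (simp add: s_def add_nonneg_pos)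
    have es: "e n \<le> (s n)\<^sup>2" for n using e0[of n] by (simp add: s_def)
    have "(\<lambda>n. 1 / real (Suc n)) \<longlonglongrightarrow> 0" using LIMSEQ_Suc[OF lim_const_over_n[of 1]] by simp
    then have "s \<longlonglongrightarrow> sqrt (0 + 0)"
      unfolding s_def using lim[OF gS] by (intro tendsto_real_sqrt tendsto_add) (simp_all add: e_def)
    then have "(\<lambda>n. c * (5 / 2 * s n)) \<longlonglongrightarrow> 0" by (auto intro!: tendsto_eq_intros)
    moreover have "norm (M n (\<lambda>x. h (g \<otimes> x)) - M n h) \<le> c * (5 / 2 * s n)" for n
    proof -
      define D where "D = (\<Sum>\<^sub>\<infinity>x\<in>carrier G. (f n x - f n (inv g \<otimes> x))\<^sup>2)"
      have "\<bar>M n (\<lambda>x. h (g \<otimes> x)) - M n h\<bar> \<le> c * (D / (2 * s n) + 2 * s n * normsq (f n)) / normsq (f n)"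
        unfolding M_def diff_divide_distrib[symmetric] abs_divide D_def
        using square_diff_bound[OF f(1) g h c s0, of n n] f(2)[of n]
        by (simp add: divide_right_mono)
      also have "\<dots> = c * (e n / (2 * s n) + 2 * s n)"
        using f(2)[of n] s0[of n] by (simp add: e_def D_def field_simps)
      also have "\<dots> \<le> c * ((s n)\<^sup>2 / (2 * s n) + 2 * s n)"
        using es[of n] s0[of n] c0 by (intro mult_left_mono add_right_mono divide_right_mono) auto
      also have "\<dots> = c * (5 / 2 * s n)" using s0[of n] by (simp add: field_simps power2_eq_square)
      finally show ?thesis by simp
    qed
    ultimately have "(\<lambda>n. M n (\<lambda>x. h (g \<otimes> x)) - M n h) \<longlonglongrightarrow> 0"
      by (rule Lim_null_comparison[OF always_eventually[OF allI], rotated])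
    then show "L (\<lambda>x. h (g \<otimes> x)) = L h" by (rule L(2)[OF linfty_translate[OF is_group h g] h])
  qed
qed

end

text \<open>Tonelli: summed over \<open>x\<close> first, each \<open>s\<close> contributes
  \<open>\<mu> s * S\<close>, and nonnegativity permits the exchange of the sums.\<close>

lemma (in group_measure) convolution_has_sum:
  assumes h: "\<And>x. x \<in> carrier G \<Longrightarrow> 0 \<le> h x" "(h has_sum S) (carrier G)"
  shows "(convolution G \<mu> h has_sum ((\<Sum>\<^sub>\<infinity>s\<in>carrier G. \<mu> s) * S)) (carrier G)"
proof -
  define f where "f = (\<lambda>(s, x). \<mu> s * h (inv s \<otimes> x))"
  have row: "((\<lambda>x. f (s, x)) has_sum (\<mu> s * S)) (carrier G)" if "s \<in> carrier G" for s
    unfolding f_def prod.case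
    using has_sum_translate[OF inv_closed[OF that] h(2)] by (rule has_sum_cmult_right)
  have rows: "((\<lambda>s. \<mu> s * S) has_sum ((\<Sum>\<^sub>\<infinity>s\<in>carrier G. \<mu> s) * S)) (carrier G)"
    using summable by (intro has_sum_cmult_left has_sum_infsum)
  have "f summable_on carrier G \<times> carrier G"
    using row has_sum_imp_summable[OF rows] by (rule summable_on_SigmaI) (auto simp: f_def nonneg h)
  with row rows have "(f has_sum ((\<Sum>\<^sub>\<infinity>s\<in>carrier G. \<mu> s) * S)) (carrier G \<times> carrier G)"
    by (rule has_sum_SigmaI)
  then have sw: "((\<lambda>(x, s). f (s, x)) has_sum ((\<Sum>\<^sub>\<infinity>s\<in>carrier G. \<mu> s) * S)) (carrier G \<times> carrier G)"
    by (subst (asm) has_sum_swap)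
  show ?thesis
  proof (rule has_sum_SigmaD[OF sw])
    fix x assume x: "x \<in> carrier G"
    have "(\<lambda>s. f (s, x)) summable_on carrier G"
      using has_sum_imp_summable[OF sw] x by (rule summable_on_SigmaD1)
    then show "((\<lambda>s. case (x, s) of (x, s) \<Rightarrow> f (s, x)) has_sum convolution G \<mu> h x) (carrier G)"
      by (simp add: f_def convolution_def)
  qed
qed

section \<open>Lazy walks and the decay of their square norms\<close>

locale sub_prob_measure = group_measure +
  assumes total: "(\<Sum>\<^sub>\<infinity>s\<in>carrier G. \<mu> s) \<le> 1"
begin

text \<open>Without the identity part, a function whose norm is nearly preserved by the convolution need
  not be close to its own translates (consider periodic walks).\<close>

definition lazy :: "('a \<Rightarrow> real) \<Rightarrow> 'a \<Rightarrow> real" where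
  "lazy f x = (f x + convolution G \<mu> f x) / 2"

text \<open>The first two claims come from one nonnegative quantity, the second moment of
  \<open>f (inv s \<otimes> x)\<close> about a constant \<open>c\<close>, summed over
  \<open>s\<close> with weights \<open>\<mu> s\<close>. Taking \<open>c\<close> to be the
  convolution itself gives the first; taking \<open>c = f x\<close> and keeping only the term
  \<open>s = g\<close> gives the second.\<close>

lemma convolution_square:
  assumes f: "square_summable f" and x: "x \<in> carrier G"
  shows "(convolution G \<mu> f x)\<^sup>2 \<le> convolution G \<mu> (\<lambda>y. (f y)\<^sup>2) x" (is ?A)
    and "g \<in> carrier G \<Longrightarrow> 2 * f x * convolution G \<mu> f x \<le>
      (f x)\<^sup>2 + convolution G \<mu> (\<lambda>y. (f y)\<^sup>2) x - \<mu> g * (f x - f (inv g \<otimes> x))\<^sup>2" (is "_ \<Longrightarrow> ?B")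
    and "0 \<le> convolution G \<mu> f x \<and> convolution G \<mu> f x \<le> 1"
proof -
  define N p q where "N = (\<Sum>\<^sub>\<infinity>s\<in>carrier G. \<mu> s)" and "p = convolution G \<mu> f x"
    and "q = convolution G \<mu> (\<lambda>y. (f y)\<^sup>2) x"
  have b: "0 \<le> f y \<and> f y \<le> 1" if "y \<in> carrier G" for y
    using f that by (simp add: square_summable_def)
  have N: "(\<mu> has_sum N) (carrier G)" using summable by (simp add: N_def)
  have p: "((\<lambda>s. \<mu> s * f (inv s \<otimes> x)) has_sum p) (carrier G)"
    using summable_mult_bounded[of f 1 x] b x by (simp add: p_def convolution_def)
  have q: "((\<lambda>s. \<mu> s * (f (inv s \<otimes> x))\<^sup>2) has_sum q) (carrier G)"
    using summable_mult_bounded[of "\<lambda>y. (f y)\<^sup>2" 1 x] b x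
    by (simp add: q_def convolution_def abs_square_le_1 power_le_one)
  have N1: "0 \<le> N" "N \<le> 1" using total nonneg by (auto simp: N_def intro: infsum_nonneg)
  have var: "((\<lambda>s. \<mu> s * (c - f (inv s \<otimes> x))\<^sup>2) has_sum (c\<^sup>2 * N - 2 * c * p + q)) (carrier G)" for c
  proof -
    have "((\<lambda>s. c\<^sup>2 * \<mu> s + (- 2 * c) * (\<mu> s * f (inv s \<otimes> x)) + \<mu> s * (f (inv s \<otimes> x))\<^sup>2)
        has_sum (c\<^sup>2 * N + (- 2 * c) * p + q)) (carrier G)"
      using N p q by (intro has_sum_add has_sum_cmult_right)
    then show ?thesis by (simp add: power2_diff algebra_simps)
  qed
  have "0 \<le> p\<^sup>2 * N - 2 * p * p + q"
    using has_sum_nonneg[OF var[of p]] nonneg by simp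
  moreover have "p\<^sup>2 * N \<le> p\<^sup>2" using N1 by (simp add: mult_left_le)
  ultimately show ?A unfolding p_def[symmetric] q_def[symmetric] by (simp add: power2_eq_square)
  show ?B if g: "g \<in> carrier G"
  proof -
    have "\<mu> g * (f x - f (inv g \<otimes> x))\<^sup>2 \<le> (f x)\<^sup>2 * N - 2 * f x * p + q"
      using finite_sum_le_has_sum[OF var[of "f x"], of "{g}"] g nonneg by simp
    moreover have "(f x)\<^sup>2 * N \<le> (f x)\<^sup>2" using N1 by (simp add: mult_left_le)
    ultimately show ?thesis unfolding p_def[symmetric] q_def[symmetric] by simp
  qed
  have "p \<le> N" using p N
  proof (rule has_sum_mono)
    show "\<mu> s * f (inv s \<otimes> x) \<le> \<mu> s" if "s \<in> carrier G" for s
      using b[of "inv s \<otimes> x"] nonneg[OF that] that x by (simp add: mult_left_le)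
  qed
  moreover have "0 \<le> p" using p by (rule has_sum_nonneg) (use b nonneg x in auto)
  ultimately show "0 \<le> convolution G \<mu> f x \<and> convolution G \<mu> f x \<le> 1"
    using N1 by (simp add: p_def)
qed

text \<open>When the square of the average is expanded, the loss comes from the mixed term, and the
  1/4 from squaring the 1/2 in \<open>lazy\<close>. What remains is the average of \<open>f\<close>
  squared and its convolution, whose sum is at most \<open>normsq f\<close> because the mass is at
  most 1.\<close>

lemma lazy_energy:
  assumes f: "square_summable f"
  shows "square_summable (lazy f)"
    and "g \<in> carrier G \<Longrightarrow> normsq (lazy f) \<le>
      normsq f - \<mu> g / 4 * (\<Sum>\<^sub>\<infinity>x\<in>carrier G. (f x - f (inv g \<otimes> x))\<^sup>2)"
proof -
  define q where "q = convolution G \<mu> (\<lambda>y. (f y)\<^sup>2)"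
  define N where "N = (\<Sum>\<^sub>\<infinity>s\<in>carrier G. \<mu> s)"
  have f2: "((\<lambda>x. (f x)\<^sup>2) has_sum normsq f) (carrier G)"
    using f by (simp add: square_summable_def normsq_def)
  have q: "(q has_sum (N * normsq f)) (carrier G)"
    unfolding q_def N_def by (rule convolution_has_sum[OF _ f2]) simp
  have "0 \<le> normsq f" using f2 by (rule has_sum_nonneg) simp
  then have qle: "N * normsq f \<le> normsq f"
    using mult_right_mono[OF total] by (simp add: N_def)
  have pt: "(lazy f x)\<^sup>2 \<le> (f x)\<^sup>2 / 2 + q x / 2 - \<mu> g / 4 * (f x - f (inv g \<otimes> x))\<^sup>2"
    if x: "x \<in> carrier G" and g: "g \<in> carrier G" for x g
  proof -
    have "(lazy f x)\<^sup>2 = (f x)\<^sup>2 / 4 + 2 * f x * convolution G \<mu> f x / 4 + (convolution G \<mu> f x)\<^sup>2 / 4"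
      by (simp add: lazy_def power2_eq_square algebra_simps add_divide_distrib)
    then show ?thesis
      using convolution_square(1)[OF f x] convolution_square(2)[OF f x g] by (simp add: q_def)
  qed
  have dom: "(\<lambda>x. (f x)\<^sup>2 / 2 + q x / 2) summable_on carrier G"
    using has_sum_add[OF has_sum_divide_const[OF f2, of 2] has_sum_divide_const[OF q, of 2]]
    by (rule has_sum_imp_summable)
  have sq: "(\<lambda>x. (lazy f x)\<^sup>2) summable_on carrier G"
    using dom
  proof (rule summable_on_comparison_test)
    fix x assume x: "x \<in> carrier G"
    show "(lazy f x)\<^sup>2 \<le> (f x)\<^sup>2 / 2 + q x / 2"
      using pt[OF x one_closed] x by simp
  qed simp
  show ss: "square_summable (lazy f)"
    unfolding square_summable_def
  proof (intro conjI ballI sq)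
    fix x assume x: "x \<in> carrier G"
    have "0 \<le> f x" "f x \<le> 1" using f x by (simp_all add: square_summable_def)
    then show "0 \<le> lazy f x" "lazy f x \<le> 1"
      using convolution_square(3)[OF f x] by (simp_all add: lazy_def)
  qed
  assume g: "g \<in> carrier G"
  define D where "D = (\<Sum>\<^sub>\<infinity>x\<in>carrier G. (f x - f (inv g \<otimes> x))\<^sup>2)"
  have D: "((\<lambda>x. (f x - f (inv g \<otimes> x))\<^sup>2) has_sum D) (carrier G)"
    unfolding D_def using square_summable_diff[OF f inv_closed[OF g]] by simp
  have "normsq (lazy f) \<le> normsq f / 2 + N * normsq f / 2 + - (\<mu> g / 4) * D"
  proof (rule has_sum_mono)
    show "((\<lambda>x. (lazy f x)\<^sup>2) has_sum normsq (lazy f)) (carrier G)" using sq by (simp add: normsq_def)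
    show "((\<lambda>x. (f x)\<^sup>2 / 2 + q x / 2 + - (\<mu> g / 4) * (f x - f (inv g \<otimes> x))\<^sup>2)
        has_sum (normsq f / 2 + N * normsq f / 2 + - (\<mu> g / 4) * D)) (carrier G)"
      using f2 q D by (intro has_sum_add has_sum_divide_const has_sum_cmult_right)
    show "(lazy f x)\<^sup>2 \<le> (f x)\<^sup>2 / 2 + q x / 2 + - (\<mu> g / 4) * (f x - f (inv g \<otimes> x))\<^sup>2"
      if "x \<in> carrier G" for x using pt[OF that g] by simp
  qed
  then show "normsq (lazy f) \<le> normsq f - \<mu> g / 4 * (\<Sum>\<^sub>\<infinity>x\<in>carrier G. (f x - f (inv g \<otimes> x))\<^sup>2)"
    using qle unfolding D_def by simp
qed

definition lazy_power :: "nat \<Rightarrow> 'a \<Rightarrow> real" where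
  "lazy_power n = (lazy ^^ n) (\<lambda>x. if x = \<one> then 1 else 0)"

lemma lazy_power_Suc: "lazy_power (Suc n) = lazy (lazy_power n)"
  by (simp add: lazy_power_def)

lemma lazy_power_0:
  "square_summable (lazy_power 0)" "normsq (lazy_power 0) = 1"
proof -
  have "((\<lambda>x. (lazy_power 0 x)\<^sup>2) has_sum (lazy_power 0 \<one>)\<^sup>2) (carrier G)"
    by (rule has_sum_finite_neutralI[of "{\<one>}"]) (auto simp: lazy_power_def)
  then show "square_summable (lazy_power 0)" "normsq (lazy_power 0) = 1"
    by (auto simp: square_summable_def normsq_def lazy_power_def infsumI dest: has_sum_imp_summable)
qed

lemma square_summable_lazy_power: "square_summable (lazy_power n)"
  by (induction n) (simp_all add: lazy_power_0 lazy_power_Suc lazy_energy)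

text \<open>The lazy power is the binomial mixture of the convolution powers; one term of it is
  kept, and Pascal's rule drives the induction.\<close>

lemma lazy_power_ge:
  assumes "x \<in> carrier G"
  shows "real (n choose k) / 2 ^ n * conv_power G \<mu> k x \<le> lazy_power n x"
  using assms
proof (induction n arbitrary: k x)
  case 0
  then show ?case by (cases k) (simp_all add: lazy_power_def)
next
  case (Suc n)
  note b = square_summable_lazy_power[of n, unfolded square_summable_def]
  have P: "real (n choose j) / 2 ^ n * conv_power G \<mu> (Suc j) x \<le> convolution G \<mu> (lazy_power n) x" for j
  proof -
    have "real (n choose j) / 2 ^ n * conv_power G \<mu> (Suc j) x =
        (\<Sum>\<^sub>\<infinity>s\<in>carrier G. real (n choose j) / 2 ^ n * (\<mu> s * conv_power G \<mu> j (inv s \<otimes> x)))"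
      unfolding conv_power.simps convolution_def by (rule infsum_cmult_right'[symmetric])
    also have "\<dots> \<le> convolution G \<mu> (lazy_power n) x"
      unfolding convolution_def
    proof (rule infsum_mono)
      show "(\<lambda>s. real (n choose j) / 2 ^ n * (\<mu> s * conv_power G \<mu> j (inv s \<otimes> x))) summable_on carrier G"
        using conv_power_summable[OF Suc.prems] by (rule summable_on_cmult_right)
      show "(\<lambda>s. \<mu> s * lazy_power n (inv s \<otimes> x)) summable_on carrier G"
        using b Suc.prems by (intro summable_mult_bounded[of _ 1]) auto
      fix s assume s: "s \<in> carrier G"
      show "real (n choose j) / 2 ^ n * (\<mu> s * conv_power G \<mu> j (inv s \<otimes> x)) \<le> \<mu> s * lazy_power n (inv s \<otimes> x)"
        using mult_left_mono[OF Suc.IH[of "inv s \<otimes> x" j] nonneg[OF s]] s Suc.prems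
        by (simp add: ac_simps)
    qed
    finally show ?thesis .
  qed
  show ?case
  proof (cases k)
    case 0
    have "0 \<le> convolution G \<mu> (lazy_power n) x"
      using convolution_square(3)[OF square_summable_lazy_power Suc.prems] by blast
    then show ?thesis using Suc.IH[OF Suc.prems, of 0] 0 by (simp add: lazy_power_Suc lazy_def)
  next
    case (Suc j)
    have "real (Suc n choose k) / 2 ^ Suc n * conv_power G \<mu> k x =
        (real (n choose k) / 2 ^ n * conv_power G \<mu> k x +
         real (n choose j) / 2 ^ n * conv_power G \<mu> (Suc j) x) / 2"
      unfolding Suc binomial_Suc_Suc of_nat_add power_Suc by (simp add: field_simps)
    also have "\<dots> \<le> (lazy_power n x + convolution G \<mu> (lazy_power n) x) / 2"
      using add_mono[OF Suc.IH[OF Suc.prems, of k] P[of j]] by (rule divide_right_mono) simp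
    finally show ?thesis by (simp add: lazy_power_Suc lazy_def)
  qed
qed

lemma value_le_normsq:
  assumes "square_summable f" "x \<in> carrier G"
  shows "(f x)\<^sup>2 \<le> normsq f"
  using finite_sum_le_infsum[of "\<lambda>x. (f x)\<^sup>2" "carrier G" "{x}"] assms
  by (simp add: square_summable_def normsq_def)

lemma normsq_lazy_power_pos: "0 < normsq (lazy_power n)"
proof -
  have "0 < lazy_power n \<one>"
    using lazy_power_ge[OF one_closed, of n 0] by (auto intro: less_le_trans[rotated])
  then have "0 < (lazy_power n \<one>)\<^sup>2" by simp
  then show ?thesis using value_le_normsq[OF square_summable_lazy_power one_closed] by (rule less_le_trans)
qed

text \<open>The vector is a lazy power whose next step loses at most the fraction \<open>d\<close>
  of the square norm; the 4 inverts the 1/4 of \<open>lazy_energy\<close>. If no such power existed,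
  geometric decay of the square norms would force the spectral radius down to
  \<open>1 - d\<close>.\<close>

lemma exists_almost_invariant:
  assumes d: "0 < d" "d < 1" and \<lambda>: "ereal (1 - d) < spectral_radius G \<mu>"
  shows "\<exists>f. square_summable f \<and> 0 < normsq f \<and>
    (\<forall>g\<in>carrier G. \<mu> g * (\<Sum>\<^sub>\<infinity>x\<in>carrier G. (f x - f (inv g \<otimes> x))\<^sup>2) \<le> 4 * d * normsq f)"
proof -
  have "\<exists>n. (1 - d) * normsq (lazy_power n) \<le> normsq (lazy_power (Suc n))"
  proof (rule ccontr)
    assume "\<not> ?thesis"
    then have less: "normsq (lazy_power (Suc n)) \<le> (1 - d) * normsq (lazy_power n)" for n
      by (meson linear)
    have decay: "normsq (lazy_power n) \<le> (1 - d) ^ n" for n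
    proof (induction n)
      case (Suc n)
      have "normsq (lazy_power (Suc n)) \<le> (1 - d) * normsq (lazy_power n)" by (rule less)
      also have "\<dots> \<le> (1 - d) * (1 - d) ^ n" using Suc d by (intro mult_left_mono) auto
      finally show ?case by simp
    qed (simp add: lazy_power_0)
    have "spectral_radius G \<mu> \<le> ereal (1 - d)"
    proof (rule spectral_radius_le[of _ _ 2])
      fix n :: nat assume n: "n > 0"
      \<comment> \<open>Among the binomial weights at time \<open>2 * n\<close> the one of index
        \<open>n\<close> is largest. Its reciprocal grows only linearly, which
        \<open>spectral_radius_le\<close> absorbs, and the doubled time compensates for the square
        root between a value and the square norm.\<close>
      have "1 / (2 * real n) \<le> real ((2 * n) choose n) / 2 ^ (2 * n)"
        using divide_right_mono[OF central_binomial_lower_bound[OF n], of "4 ^ n"]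
        by (simp add: power_mult)
      then have "1 / (2 * real n) * conv_power G \<mu> n \<one> \<le>
          real ((2 * n) choose n) / 2 ^ (2 * n) * conv_power G \<mu> n \<one>"
        by (rule mult_right_mono) (simp add: conv_power_nonneg)
      also have "\<dots> \<le> lazy_power (2 * n) \<one>" by (rule lazy_power_ge) simp
      also have "\<dots> \<le> (1 - d) ^ n"
      proof (rule power2_le_imp_le)
        have "(lazy_power (2 * n) \<one>)\<^sup>2 \<le> (1 - d) ^ (2 * n)"
          using value_le_normsq[OF square_summable_lazy_power one_closed, of "2 * n"] decay[of "2 * n"]
          by simp
        then show "(lazy_power (2 * n) \<one>)\<^sup>2 \<le> ((1 - d) ^ n)\<^sup>2"
          by (simp only: power_even_eq)
      qed (use d in simp)
      finally show "conv_power G \<mu> n \<one> \<le> 2 * real n * (1 - d) ^ n"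
        using n by (simp add: field_simps)
    qed (use d in auto)
    then show False using \<lambda> by simp
  qed
  then obtain n where n: "(1 - d) * normsq (lazy_power n) \<le> normsq (lazy (lazy_power n))"
    by (auto simp: lazy_power_Suc)
  have "\<mu> g * (\<Sum>\<^sub>\<infinity>x\<in>carrier G. (lazy_power n x - lazy_power n (inv g \<otimes> x))\<^sup>2)
      \<le> 4 * d * normsq (lazy_power n)" if "g \<in> carrier G" for g
    using lazy_energy(2)[OF square_summable_lazy_power that, of n] n by (simp add: algebra_simps)
  then show ?thesis using square_summable_lazy_power normsq_lazy_power_pos by blast
qed

end

subsection \<open>Pushforwards and the torsion-free abelianisation\<close>

lemma (in group) semigroup_generate_subset:
  assumes "S \<subseteq> carrier G"
  shows "semigroup_generate G S \<subseteq> carrier G"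
proof
  fix x assume "x \<in> semigroup_generate G S"
  then show "x \<in> carrier G" by induction (use assms in auto)
qed

lemma (in group) nondegenerate_generate:
  assumes "nondegenerate G \<mu>"
  shows "generate G (measure_support G \<mu>) = carrier G"
proof
  show "generate G (measure_support G \<mu>) \<subseteq> carrier G"
    by (rule generate_incl) (auto simp: measure_support_def)
  show "carrier G \<subseteq> generate G (measure_support G \<mu>)"
  proof
    fix x assume "x \<in> carrier G"
    then have "x \<in> semigroup_generate G (measure_support G \<mu>)"
      using assms by (simp add: nondegenerate_def)
    then show "x \<in> generate G (measure_support G \<mu>)"
      by induction (auto intro: generate.intros)
  qed
qed

lemma finitely_generated_hom_image:
  assumes "group G" "group H" "h \<in> hom G H" "h ` carrier G = carrier H" "finitely_generated G"
  shows "finitely_generated H"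
proof -
  interpret group_hom G H h using assms by (simp add: group_hom_def group_hom_axioms_def)
  obtain S where S: "finite S" "S \<subseteq> carrier G" "generate G S = carrier G"
    using assms(5) by (auto simp: finitely_generated_def)
  then have "generate H (h ` S) = carrier H" using generate_img[OF S(2)] assms(4) by simp
  moreover have "h ` S \<subseteq> carrier H" using S(2) by auto
  ultimately show ?thesis using S(1) unfolding finitely_generated_def by blast
qed

section \<open>Exponential twists and pushforwards of a measure\<close>

context group_measure
begin

lemma conv_power_twist:
  assumes \<xi>: "additive_character G \<xi>" and "x \<in> carrier G"
  shows "conv_power G (\<lambda>g. c * (\<mu> g * exp (\<xi> g))) n x = c ^ n * exp (\<xi> x) * conv_power G \<mu> n x"
  using assms(2)
proof (induction n arbitrary: x)
  case 0
  then show ?case using additive_character_one[OF \<xi>] by simp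
next
  case (Suc n)
  have "conv_power G (\<lambda>g. c * (\<mu> g * exp (\<xi> g))) (Suc n) x =
      (\<Sum>\<^sub>\<infinity>s\<in>carrier G. c ^ Suc n * exp (\<xi> x) * (\<mu> s * conv_power G \<mu> n (inv s \<otimes> x)))"
    unfolding conv_power.simps convolution_def
  proof (rule infsum_cong)
    fix s assume s: "s \<in> carrier G"
    have "\<xi> x = \<xi> (s \<otimes> (inv s \<otimes> x))" using s Suc.prems by (simp add: m_assoc[symmetric])
    also have "\<dots> = \<xi> s + \<xi> (inv s \<otimes> x)"
      using \<xi> s Suc.prems by (simp add: additive_character_def)
    finally show "c * (\<mu> s * exp (\<xi> s)) * conv_power G (\<lambda>g. c * (\<mu> g * exp (\<xi> g))) n (inv s \<otimes> x) =
        c ^ Suc n * exp (\<xi> x) * (\<mu> s * conv_power G \<mu> n (inv s \<otimes> x))"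
      using Suc.IH[of "inv s \<otimes> x"] s Suc.prems by (simp add: exp_add)
  qed
  also have "\<dots> = c ^ Suc n * exp (\<xi> x) * conv_power G \<mu> (Suc n) x"
    unfolding conv_power.simps convolution_def by (rule infsum_cmult_right')
  finally show ?case .
qed

text \<open>A character is 0 at the identity, so return values see only the factor \<open>c\<close>
  of each step.\<close>

lemma spectral_radius_twist:
  assumes "additive_character G \<xi>" "0 \<le> c"
  shows "spectral_radius G (\<lambda>g. c * (\<mu> g * exp (\<xi> g))) = ereal c * spectral_radius G \<mu>"
proof -
  have "eventually (\<lambda>n. ereal (root n (conv_power G (\<lambda>g. c * (\<mu> g * exp (\<xi> g))) n \<one>)) =
      ereal c * ereal (root n (conv_power G \<mu> n \<one>))) sequentially"
    using eventually_gt_at_top[of 0]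
    by eventually_elim (use assms in \<open>simp add: conv_power_twist additive_character_one
      real_root_mult real_root_power_cancel\<close>)
  then show ?thesis
    unfolding spectral_radius_def limsup_ereal_mult_left[OF assms(2), symmetric] by (rule Limsup_eq)
qed

lemma pushforward_has_sum:
  "(\<mu> has_sum pushforward G \<pi> \<mu> m) {g \<in> carrier G. \<pi> g = m}"
  unfolding pushforward_def using summable_on_subset[OF summable] by (intro has_sum_infsum) auto

text \<open>This and \<open>sum_pushforward_le\<close> are the two halves of the change of
  variables. Both are phrased with finite sums, so that convergence of the weighted sums is not
  presupposed.\<close>

lemma pushforward_sum_le:
  assumes "finite F" "F \<subseteq> carrier G" "\<And>m. 0 \<le> w m"
  shows "(\<Sum>s\<in>F. \<mu> s * w (\<pi> s)) \<le> (\<Sum>m\<in>\<pi> ` F. pushforward G \<pi> \<mu> m * w m)"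
proof -
  have "(\<Sum>s\<in>F. \<mu> s * w (\<pi> s)) = (\<Sum>m\<in>\<pi> ` F. \<Sum>s\<in>{s \<in> F. \<pi> s = m}. \<mu> s * w (\<pi> s))"
    using assms(1) by (subst sum.group) auto
  also have "\<dots> = (\<Sum>m\<in>\<pi> ` F. (\<Sum>s\<in>{s \<in> F. \<pi> s = m}. \<mu> s) * w m)"
    by (simp add: sum_distrib_right)
  also have "\<dots> \<le> (\<Sum>m\<in>\<pi> ` F. pushforward G \<pi> \<mu> m * w m)"
  proof (intro sum_mono mult_right_mono)
    show "(\<Sum>s\<in>{s \<in> F. \<pi> s = m}. \<mu> s) \<le> pushforward G \<pi> \<mu> m" for m
      by (rule finite_sum_le_has_sum[OF pushforward_has_sum]) (use assms nonneg in auto)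
  qed (use assms(3) in auto)
  finally show ?thesis .
qed

text \<open>The fibres over the finite set \<open>F'\<close> may be infinite, so the bound has to be
  assumed for all finite subsets of the group.\<close>

lemma sum_pushforward_le:
  assumes "finite F'" and bound: "\<And>F. finite F \<Longrightarrow> F \<subseteq> carrier G \<Longrightarrow> (\<Sum>s\<in>F. \<mu> s * w (\<pi> s)) \<le> r"
  shows "(\<Sum>m\<in>F'. pushforward G \<pi> \<mu> m * w m) \<le> r"
proof -
  have "((\<lambda>s. \<mu> s * w (\<pi> s)) has_sum (\<Sum>m\<in>F'. pushforward G \<pi> \<mu> m * w m))
      (\<Union>m\<in>F'. {g \<in> carrier G. \<pi> g = m})"
    using assms(1)
  proof (rule sum_has_sum)
    show "((\<lambda>s. \<mu> s * w (\<pi> s)) has_sum (pushforward G \<pi> \<mu> m * w m)) {g \<in> carrier G. \<pi> g = m}" for m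
      using has_sum_cmult_left[OF pushforward_has_sum, of "w m"]
      by (rule has_sum_cong[THEN iffD1, rotated]) simp
  qed auto
  then show ?thesis by (rule has_sum_le_finite_sums) (rule bound, auto)
qed

lemma group_measure_pushforward:
  assumes "group H"
  shows "group_measure H (pushforward G \<pi> \<mu>)"
proof -
  interpret H: group H by fact
  have nn: "0 \<le> pushforward G \<pi> \<mu> m" for m
    using nonneg by (auto simp: pushforward_def intro: infsum_nonneg)
  have "(\<Sum>m\<in>F'. pushforward G \<pi> \<mu> m * 1) \<le> (\<Sum>\<^sub>\<infinity>s\<in>carrier G. \<mu> s)" if "finite F'" for F'
    using that finite_sum_le_infsum[OF summable] nonneg by (intro sum_pushforward_le) auto
  then have "pushforward G \<pi> \<mu> summable_on carrier H"
    using nn by (intro nonneg_bdd_above_summable_on) (auto simp: bdd_above_def)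
  with nn show ?thesis by unfold_locales
qed

lemma laplace_le_pushforward:
  assumes "\<pi> ` carrier G \<subseteq> carrier H"
  shows "laplace_le H (pushforward G \<pi> \<mu>) \<xi> r \<longleftrightarrow> laplace_le G \<mu> (\<lambda>g. \<xi> (\<pi> g)) r"
proof
  assume L: "laplace_le H (pushforward G \<pi> \<mu>) \<xi> r"
  show "laplace_le G \<mu> (\<lambda>g. \<xi> (\<pi> g)) r"
    unfolding laplace_le_def
  proof (intro allI impI, elim conjE)
    fix F assume F: "finite F" "F \<subseteq> carrier G"
    then have "(\<Sum>m\<in>\<pi> ` F. pushforward G \<pi> \<mu> m * exp (\<xi> m)) \<le> r"
      using L assms unfolding laplace_le_def by blast
    with pushforward_sum_le[OF F, of "\<lambda>m. exp (\<xi> m)" \<pi>]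
    show "(\<Sum>s\<in>F. \<mu> s * exp (\<xi> (\<pi> s))) \<le> r" by simp
  qed
next
  assume "laplace_le G \<mu> (\<lambda>g. \<xi> (\<pi> g)) r"
  then show "laplace_le H (pushforward G \<pi> \<mu>) \<xi> r"
    unfolding laplace_le_def using sum_pushforward_le[of _ "\<lambda>m. exp (\<xi> m)" \<pi> r] by simp
qed

lemma nondegenerate_pushforward:
  assumes H: "group H" "\<pi> \<in> hom G H" "\<pi> ` carrier G = carrier H" and nd: "nondegenerate G \<mu>"
  shows "nondegenerate H (pushforward G \<pi> \<mu>)"
proof -
  have supp: "\<pi> g \<in> measure_support H (pushforward G \<pi> \<mu>)" if "g \<in> measure_support G \<mu>" for g
  proof -
    have "\<mu> g \<le> pushforward G \<pi> \<mu> (\<pi> g)"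
      using finite_sum_le_has_sum[OF pushforward_has_sum, of "{g}" \<pi> "\<pi> g"] that nonneg
      by (simp add: measure_support_def)
    then show ?thesis using that H(3) by (auto simp: measure_support_def)
  qed
  have "\<pi> g \<in> semigroup_generate H (measure_support H (pushforward G \<pi> \<mu>))"
    if "g \<in> carrier G" for g
  proof -
    have "g \<in> semigroup_generate G (measure_support G \<mu>)" using nd that by (simp add: nondegenerate_def)
    then have "g \<in> carrier G \<and> \<pi> g \<in> semigroup_generate H (measure_support H (pushforward G \<pi> \<mu>))"
    proof induction
      case (incl s)
      then have "s \<in> carrier G" by (simp add: measure_support_def)
      then show ?case using semigroup_generate.incl[OF supp[OF incl]] by blast
    next
      case (mult x y)
      then have "\<pi> (x \<otimes> y) = \<pi> x \<otimes>\<^bsub>H\<^esub> \<pi> y" using H(2) by (simp add: hom_mult)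
      moreover have "\<pi> x \<otimes>\<^bsub>H\<^esub> \<pi> y \<in> semigroup_generate H (measure_support H (pushforward G \<pi> \<mu>))"
        using mult.IH by (intro semigroup_generate.mult) blast+
      ultimately show ?case using mult.IH by simp
    qed
    then show ?thesis by blast
  qed
  then have "carrier H \<subseteq> semigroup_generate H (measure_support H (pushforward G \<pi> \<mu>))"
    unfolding H(3)[symmetric] by blast
  moreover have "semigroup_generate H (measure_support H (pushforward G \<pi> \<mu>)) \<subseteq> carrier H"
    by (rule group.semigroup_generate_subset[OF H(1)]) (auto simp: measure_support_def)
  ultimately show ?thesis by (simp add: nondegenerate_def)
qed

section \<open>From characters to amenability\<close>

lemma spectral_radius_finite: "spectral_radius G \<mu> < \<infinity>"
proof -
  have "additive_character G (\<lambda>x. 0)" by (simp add: additive_character_def)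
  moreover have "laplace_le G \<mu> (\<lambda>x. 0) (\<Sum>\<^sub>\<infinity>s\<in>carrier G. \<mu> s)"
    using finite_sum_le_infsum[OF summable] nonneg by (auto simp: laplace_le_def)
  ultimately have "spectral_radius G \<mu> \<le> ereal (\<Sum>\<^sub>\<infinity>s\<in>carrier G. \<mu> s)"
    by (rule spectral_radius_le_laplace)
  then show ?thesis by (auto intro: le_less_trans)
qed

text \<open>At spectral radius 0 there would be characters with arbitrarily small \<open>r\<close>,
  but a return of positive weight at a time \<open>m > 0\<close> forces \<open>r ^ m\<close> to be
  at least that weight.\<close>

lemma tight_characters_imp_spectral_radius_pos:
  assumes nd: "nondegenerate G \<mu>"
    and tight: "\<And>r. spectral_radius G \<mu> < ereal r \<Longrightarrow>
      \<exists>\<xi>. additive_character G \<xi> \<and> laplace_le G \<mu> \<xi> r"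
  shows "0 < spectral_radius G \<mu>"
proof (rule ccontr)
  assume "\<not> ?thesis"
  then have 0: "spectral_radius G \<mu> = 0" using spectral_radius_nonneg by simp
  obtain m where m: "m > 0" "0 < conv_power G \<mu> m \<one>" (is "0 < ?c")
    using conv_power_pos[OF nd one_closed] by blast
  define r where "r = root m ?c / 2"
  have r: "0 < r" using m by (simp add: r_def)
  then obtain \<xi> where \<xi>: "additive_character G \<xi>" "laplace_le G \<mu> \<xi> r" using tight 0 by auto
  have "?c \<le> r ^ m"
    using conv_power_character_le[OF \<xi> one_closed, of m] additive_character_one[OF \<xi>(1)] by simp
  also have "\<dots> < (root m ?c) ^ m" using m r by (intro power_strict_mono) (auto simp: r_def)
  also have "\<dots> = ?c" using m by simp
  finally show False by simp
qed

lemma tight_characters_imp_amenable: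
  assumes nd: "nondegenerate G \<mu>"
    and tight: "\<And>r. spectral_radius G \<mu> < ereal r \<Longrightarrow>
      \<exists>\<xi>. additive_character G \<xi> \<and> laplace_le G \<mu> \<xi> r"
  shows "amenable G"
proof -
  note pos = tight_characters_imp_spectral_radius_pos[OF assms]
  obtain l where l: "spectral_radius G \<mu> = ereal l"
    using spectral_radius_finite pos by (cases "spectral_radius G \<mu>") auto
  have l0: "0 < l" using pos l by simp
  \<comment> \<open>The shift by 2 puts \<open>d n\<close> strictly between 0 and 1. With
    \<open>r n = l * (1 + d n)\<close> the twisted walk has spectral radius \<open>l / r n\<close>,
    which exceeds \<open>1 - d n\<close> because the product of \<open>1 - d n\<close> and
    \<open>1 + d n\<close> is below 1.\<close>
  define d where "d n = 1 / real (n + 2)" for n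
  define r where "r n = l * (1 + d n)" for n
  have d: "0 < d n" "d n < 1" for n by (auto simp: d_def)
  have r: "l < r n" "r n \<le> 2 * l" "(1 - d n) * r n < l" for n
  proof -
    show "l < r n" "r n \<le> 2 * l" using l0 d[of n] by (simp_all add: r_def)
    have "(1 - d n) * r n = l - l * (d n)\<^sup>2" by (simp add: r_def power2_eq_square algebra_simps)
    also have "\<dots> < l" using l0 d[of n] by simp
    finally show "(1 - d n) * r n < l" .
  qed
  have r0: "0 < r n" for n using r(1)[of n] l0 by simp
  have "\<exists>\<xi>. additive_character G \<xi> \<and> laplace_le G \<mu> \<xi> (r n)" for n
    using tight l r(1) by simp
  then obtain \<xi> where \<xi>: "\<And>n. additive_character G (\<xi> n)" "\<And>n. laplace_le G \<mu> (\<xi> n) (r n)"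
    by metis
  define \<nu> where "\<nu> n = (\<lambda>g. 1 / r n * (\<mu> g * exp (\<xi> n g)))" for n
  define Q where "Q n f \<longleftrightarrow> square_summable f \<and> 0 < normsq f \<and>
    (\<forall>g\<in>carrier G. \<nu> n g * (\<Sum>\<^sub>\<infinity>x\<in>carrier G. (f x - f (inv g \<otimes> x))\<^sup>2) \<le> 4 * d n * normsq f)"
    for n f
  have "\<exists>f. Q n f" for n
    unfolding Q_def
  proof (rule sub_prob_measure.exists_almost_invariant)
    show "sub_prob_measure G (\<nu> n)"
    proof unfold_locales
      show "0 \<le> \<nu> n g" if "g \<in> carrier G" for g
        using nonneg[OF that] r0[of n] by (simp add: \<nu>_def)
      show "\<nu> n summable_on carrier G"
        unfolding \<nu>_def using laplace_le_summable(1)[OF \<xi>(2)] by (rule summable_on_cmult_right)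
      have "(\<Sum>\<^sub>\<infinity>s\<in>carrier G. \<nu> n s) = 1 / r n * (\<Sum>\<^sub>\<infinity>s\<in>carrier G. \<mu> s * exp (\<xi> n s))"
        unfolding \<nu>_def by (rule infsum_cmult_right')
      also have "\<dots> \<le> 1" using laplace_le_summable(2)[OF \<xi>(2), of n] r0[of n] by (simp add: field_simps)
      finally show "(\<Sum>\<^sub>\<infinity>s\<in>carrier G. \<nu> n s) \<le> 1" .
    qed
    have "spectral_radius G (\<nu> n) = ereal (1 / r n) * ereal l"
      unfolding \<nu>_def l[symmetric] using r0[of n] by (intro spectral_radius_twist \<xi>) simp
    then show "ereal (1 - d n) < spectral_radius G (\<nu> n)"
      using r(3)[of n] r0[of n] by (simp add: field_simps)
  qed (use d in auto)
  then obtain f where Q: "\<And>n. Q n (f n)" by metis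
  then have f: "square_summable (f n)" "0 < normsq (f n)"
    and inv: "g \<in> carrier G \<Longrightarrow>
      \<nu> n g * (\<Sum>\<^sub>\<infinity>x\<in>carrier G. (f n x - f n (inv g \<otimes> x))\<^sup>2) \<le> 4 * d n * normsq (f n)" for n g
    by (simp_all add: Q_def)
  show ?thesis
  proof (rule almost_invariant_imp_amenable[OF f])
    show "measure_support G \<mu> \<subseteq> carrier G" by (auto simp: measure_support_def)
    show "generate G (measure_support G \<mu>) = carrier G" using nd by (rule nondegenerate_generate)
    fix g assume "g \<in> measure_support G \<mu>"
    then have g: "g \<in> carrier G" "0 < \<mu> g" by (auto simp: measure_support_def)
    \<comment> \<open>The character bound at \<open>inv g\<close> gives
      \<open>exp (\<xi> n g)\<close> the lower bound \<open>?c / (2 * l) ^ m\<close>, and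
      \<open>r n \<le> 2 * l\<close> bounds the normalisation; hence a \<open>\<kappa>\<close> that
      does not depend on \<open>n\<close>.\<close>
    obtain m where m: "0 < conv_power G \<mu> m (inv g)" (is "0 < ?c")
      using conv_power_pos[OF nd inv_closed[OF g(1)]] by blast
    define \<kappa> where "\<kappa> = 1 / (2 * l) * (\<mu> g * (?c / (2 * l) ^ m))"
    have \<kappa>0: "0 < \<kappa>" using l0 g m by (simp add: \<kappa>_def)
    have \<kappa>: "\<kappa> \<le> \<nu> n g" for n
    proof -
      have "?c * exp (- \<xi> n g) \<le> r n ^ m"
        using conv_power_character_le[OF \<xi>(1) \<xi>(2) inv_closed[OF g(1)], of m n]
        by (simp add: additive_character_inv[OF \<xi>(1) g(1)])
      also have "\<dots> \<le> (2 * l) ^ m" using r0[of n] r(2)[of n] by (intro power_mono) auto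
      finally have "?c / (2 * l) ^ m \<le> exp (\<xi> n g)"
        using l0 by (simp add: exp_minus field_simps)
      then show ?thesis
        unfolding \<kappa>_def \<nu>_def using l0 m g r0[of n] r(2)[of n]
        by (intro mult_mono divide_left_mono mult_left_mono mult_nonneg_nonneg divide_nonneg_pos) auto
    qed
    define e where "e n = (\<Sum>\<^sub>\<infinity>x\<in>carrier G. (f n x - f n (inv g \<otimes> x))\<^sup>2)" for n
    have e0: "0 \<le> e n" for n by (auto simp: e_def intro: infsum_nonneg)
    have "norm (e n / normsq (f n)) \<le> 4 / \<kappa> * d n" for n
    proof -
      have "\<kappa> * e n \<le> 4 * d n * normsq (f n)"
        using order_trans[OF mult_right_mono[OF \<kappa>[of n] e0[of n]]] inv[OF g(1), of n] by (simp add: e_def)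
      then have "e n / normsq (f n) \<le> 4 / \<kappa> * d n" using \<kappa>0 f(2)[of n] by (simp add: field_simps)
      then show ?thesis using e0[of n] f(2)[of n] by simp
    qed
    moreover have "(\<lambda>n. 4 / \<kappa> * d n) \<longlonglongrightarrow> 0"
      unfolding d_def
      by (rule tendsto_mult_right_zero[OF LIMSEQ_ignore_initial_segment[OF lim_const_over_n[of 1]]])
    ultimately show "(\<lambda>n. (\<Sum>\<^sub>\<infinity>x\<in>carrier G. (f n x - f n (inv g \<otimes> x))\<^sup>2) / normsq (f n)) \<longlonglongrightarrow> 0"
      unfolding e_def by (rule Lim_null_comparison[OF always_eventually[OF allI]])
  qed
qed

text \<open>The abelianisation enters through two properties only: the quotient is commutative,
  hence amenable, and characters of \<open>G\<close> are constant on the fibres of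
  \<open>\<pi>\<close>.\<close>

theorem amenable_iff_spectral_radius_pushforward:
  assumes nd: "nondegenerate G \<mu>" and fg: "finitely_generated G"
    and H: "comm_group H" "\<pi> \<in> hom G H" "\<pi> ` carrier G = carrier H"
    and factor: "\<And>\<xi> g h. additive_character G \<xi> \<Longrightarrow> g \<in> carrier G \<Longrightarrow> h \<in> carrier G \<Longrightarrow>
      \<pi> g = \<pi> h \<Longrightarrow> \<xi> g = \<xi> h"
  shows "amenable G \<longleftrightarrow> spectral_radius G \<mu> = spectral_radius H (pushforward G \<pi> \<mu>)"
proof -
  interpret H: comm_group H by fact
  interpret P: group_measure H "pushforward G \<pi> \<mu>"
    using H.is_group by (rule group_measure_pushforward)
  have amenH: "amenable H"
    using H(1) finitely_generated_hom_image[OF is_group H.is_group H(2,3) fg] by (rule comm_group_amenable)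
  \<comment> \<open>This rests on the amenability of the quotient and so holds for every
    \<open>G\<close>. It gives one inequality between the radii in general, and it supplies the
    characters for the converse once the radii agree.\<close>
  have pull: "\<exists>\<xi>. additive_character G \<xi> \<and> laplace_le G \<mu> \<xi> r"
    if r: "spectral_radius H (pushforward G \<pi> \<mu>) < ereal r" for r
  proof -
    obtain \<xi> where "additive_character H \<xi>" "laplace_le H (pushforward G \<pi> \<mu>) \<xi> r"
      using P.amenable_imp_character[OF amenH nondegenerate_pushforward[OF H.is_group H(2,3) nd] r]
      by blast
    moreover from this(1) have "additive_character G (\<lambda>g. \<xi> (\<pi> g))"
      using H(2) by (simp add: additive_character_def hom_mult hom_in_carrier)
    ultimately show ?thesis using laplace_le_pushforward[of \<pi> H \<xi> r] H(3) by auto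
  qed
  show ?thesis
  proof
    assume amen: "amenable G"
    have "spectral_radius H (pushforward G \<pi> \<mu>) \<le> ereal r" if r: "spectral_radius G \<mu> < ereal r" for r
    proof -
      obtain \<xi> where \<xi>: "additive_character G \<xi>" "laplace_le G \<mu> \<xi> r"
        using amenable_imp_character[OF amen nd r] by blast
      \<comment> \<open>The choice of the preimage is harmless by \<open>factor\<close>, so
        \<open>\<xi>\<close> descends to the quotient.\<close>
      define \<eta> where "\<eta> m = \<xi> (SOME g. g \<in> carrier G \<and> \<pi> g = m)" for m
      have \<eta>: "\<eta> (\<pi> g) = \<xi> g" if "g \<in> carrier G" for g
      proof -
        have "(SOME h. h \<in> carrier G \<and> \<pi> h = \<pi> g) \<in> carrier G \<and> \<pi> (SOME h. h \<in> carrier G \<and> \<pi> h = \<pi> g) = \<pi> g"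
          using that by (intro someI[of "\<lambda>h. h \<in> carrier G \<and> \<pi> h = \<pi> g" g]) simp
        then show ?thesis unfolding \<eta>_def using that factor[OF \<xi>(1)] by blast
      qed
      have "additive_character H \<eta>"
        unfolding additive_character_def
      proof (intro ballI)
        fix x y assume "x \<in> carrier H" "y \<in> carrier H"
        then obtain g h where g: "g \<in> carrier G" "x = \<pi> g" and h: "h \<in> carrier G" "y = \<pi> h"
          using H(3) by blast
        then have "x \<otimes>\<^bsub>H\<^esub> y = \<pi> (g \<otimes> h)" using H(2) by (simp add: hom_mult)
        then show "\<eta> (x \<otimes>\<^bsub>H\<^esub> y) = \<eta> x + \<eta> y"
          using \<eta> g h \<xi>(1) by (simp add: additive_character_def)
      qed
      moreover have "laplace_le G \<mu> (\<lambda>g. \<eta> (\<pi> g)) r"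
        unfolding laplace_le_def
      proof (intro allI impI)
        fix F assume F: "finite F \<and> F \<subseteq> carrier G"
        then have "(\<Sum>s\<in>F. \<mu> s * exp (\<eta> (\<pi> s))) = (\<Sum>s\<in>F. \<mu> s * exp (\<xi> s))"
          using \<eta> by (intro sum.cong) auto
        with F \<xi>(2) show "(\<Sum>s\<in>F. \<mu> s * exp (\<eta> (\<pi> s))) \<le> r" by (simp add: laplace_le_def)
      qed
      then have "laplace_le H (pushforward G \<pi> \<mu>) \<eta> r" using laplace_le_pushforward[of \<pi> H] H(3) by simp
      ultimately show ?thesis by (rule P.spectral_radius_le_laplace)
    qed
    moreover have "spectral_radius G \<mu> \<le> ereal r"
      if "spectral_radius H (pushforward G \<pi> \<mu>) < ereal r" for r
      using pull[OF that] spectral_radius_le_laplace by blast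
    ultimately show "spectral_radius G \<mu> = spectral_radius H (pushforward G \<pi> \<mu>)"
      by (metis antisym_conv3 ereal_dense2 leD)
  next
    assume "spectral_radius G \<mu> = spectral_radius H (pushforward G \<pi> \<mu>)"
    then show "amenable G" using tight_characters_imp_amenable[OF nd] pull by simp
  qed
qed

end

section \<open>The torsion-free abelianisation and the factorisation of characters\<close>

lemma (in comm_group) torsion_subgroup_is_subgroup: "subgroup (torsion_subgroup G) G"
proof (rule subgroupI)
  show "torsion_subgroup G \<noteq> {}" by (auto simp: torsion_subgroup_def intro!: exI[of _ \<one>] exI[of _ 1])
  fix a assume "a \<in> torsion_subgroup G"
  then obtain m :: nat where a: "a \<in> carrier G" "m > 0" "a [^] m = \<one>" by (auto simp: torsion_subgroup_def)
  then show "inv a \<in> torsion_subgroup G"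
    by (auto simp: torsion_subgroup_def nat_pow_inv intro!: exI[of _ m])
  fix b assume "b \<in> torsion_subgroup G"
  then obtain n :: nat where b: "b \<in> carrier G" "n > 0" "b [^] n = \<one>" by (auto simp: torsion_subgroup_def)
  have "a [^] (m * n) = \<one>"
    by (simp add: nat_pow_pow[OF a(1), symmetric] a(3))
  moreover have "b [^] (m * n) = \<one>"
    by (simp add: nat_pow_pow[OF b(1), symmetric] b(3) mult.commute[of m n])
  ultimately have "(a \<otimes> b) [^] (m * n) = \<one>" using a(1) b(1) by (simp add: nat_pow_distrib)
  then show "a \<otimes> b \<in> torsion_subgroup G"
    using a b by (auto simp: torsion_subgroup_def intro!: exI[of _ "m * n"])
qed (auto simp: torsion_subgroup_def)

context group
begin

lemma derived_normal: "derived G (carrier G) \<lhd> G"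
  using derived_is_normal[OF normal_self] .

lemma comm_group_abelianisation: "comm_group (abelianisation G)"
  unfolding abelianisation_def by (rule derived_quot_is_comm_group)

lemma comm_group_torsion_free_abelianisation: "comm_group (torsion_free_abelianisation G)"
  unfolding torsion_free_abelianisation_def
  by (intro comm_group.abelian_FactGroup comm_group.torsion_subgroup_is_subgroup comm_group_abelianisation)

lemma hom_abelianisation: "(\<lambda>g. derived G (carrier G) #> g) \<in> hom G (abelianisation G)"
  unfolding abelianisation_def by (rule normal.r_coset_hom_Mod[OF derived_normal])

lemma hom_natural_projection: "natural_projection G \<in> hom G (torsion_free_abelianisation G)"
proof -
  have "torsion_subgroup (abelianisation G) \<lhd> abelianisation G"
    by (intro comm_group.subgroup_imp_normal comm_group.torsion_subgroup_is_subgroup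
        comm_group_abelianisation)
  from normal.r_coset_hom_Mod[OF this] hom_abelianisation show ?thesis
    unfolding torsion_free_abelianisation_def natural_projection_def[abs_def]
    by (auto simp: hom_def)
qed

lemma natural_projection_surj: "natural_projection G ` carrier G = carrier (torsion_free_abelianisation G)"
  unfolding torsion_free_abelianisation_def carrier_FactGroup
  by (subst (2) abelianisation_def) (simp add: carrier_FactGroup image_image natural_projection_def)

lemma additive_character_derived:
  assumes \<xi>: "additive_character G \<xi>" and "d \<in> derived G (carrier G)"
  shows "\<xi> d = 0"
proof -
  have com: "h \<in> carrier G \<and> \<xi> h = 0" if "h \<in> derived_set G (carrier G)" for h
    using that \<xi> by (auto simp: additive_character_inv additive_character_def)
  have "d \<in> carrier G \<and> \<xi> d = 0"
    using assms(2) unfolding derived_def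
  proof induction
    case one
    then show ?case using additive_character_one[OF \<xi>] by simp
  next
    case (incl h)
    then show ?case by (rule com)
  next
    case (inv h)
    then show ?case using com[OF inv] additive_character_inv[OF \<xi>] by simp
  next
    case (eng h1 h2)
    then show ?case using \<xi> by (simp add: additive_character_def)
  qed
  then show ?thesis by blast
qed

text \<open>The additive group of the reals is commutative and torsion-free. Equal projections mean
  that \<open>g\<close> and \<open>u \<otimes> h\<close> agree modulo commutators for some
  \<open>u\<close> with torsion class; commutators are killed, and
  \<open>real n * \<xi> u = 0\<close> forces \<open>\<xi> u = 0\<close>.\<close>

lemma additive_character_factors:
  assumes \<xi>: "additive_character G \<xi>" and g: "g \<in> carrier G" and h: "h \<in> carrier G"
    and eq: "natural_projection G g = natural_projection G h"
  shows "\<xi> g = \<xi> h"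
proof -
  define D where "D = derived G (carrier G)"
  interpret A: comm_group "abelianisation G" by (rule comm_group_abelianisation)
  have D: "subgroup D G" unfolding D_def using derived_normal by (rule normal_imp_subgroup)
  note hom = hom_abelianisation[folded D_def]
  have cA: "D #> x \<in> carrier (abelianisation G)" if "x \<in> carrier G" for x
    using hom that by (rule hom_in_carrier)
  have "D #> g \<in> torsion_subgroup (abelianisation G) #>\<^bsub>abelianisation G\<^esub> (D #> h)"
    using eq A.rcos_self[OF cA[OF g] A.torsion_subgroup_is_subgroup]
    by (simp add: natural_projection_def D_def)
  then obtain t where t: "t \<in> torsion_subgroup (abelianisation G)"
      "D #> g = t \<otimes>\<^bsub>abelianisation G\<^esub> (D #> h)" by (auto simp: r_coset_def)
  then obtain u n where u: "u \<in> carrier G" "t = D #> u" and n: "n > 0"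
      "t [^]\<^bsub>abelianisation G\<^esub> (n::nat) = \<one>\<^bsub>abelianisation G\<^esub>"
    by (auto simp: torsion_subgroup_def abelianisation_def carrier_FactGroup D_def)
  have \<xi>D: "\<xi> x = \<xi> y" if "x \<in> carrier G" "y \<in> carrier G" "D #> x = D #> y" for x y
  proof -
    have "x \<in> D #> y" using rcos_self[OF that(1) D] that(3) by simp
    then obtain d where d: "d \<in> D" "x = d \<otimes> y" by (auto simp: r_coset_def)
    moreover have "d \<in> carrier G" using D d(1) by (rule subgroup.mem_carrier)
    ultimately show ?thesis
      using \<xi> that(2) additive_character_derived[OF \<xi>] by (simp add: additive_character_def D_def)
  qed
  have "D #> (u [^] n) = (D #> u) [^]\<^bsub>abelianisation G\<^esub> n"
    by (rule hom_nat_pow[OF hom u(1) is_group A.is_group])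
  also have "\<dots> = D #> \<one>" using n(2) u(2) hom_one[OF hom is_group A.is_group] by simp
  finally have "\<xi> (u [^] n) = 0"
    using \<xi>D[of "u [^] n" \<one>] u(1) additive_character_one[OF \<xi>] by simp
  moreover have "\<xi> (u [^] k) = real k * \<xi> u" for k :: nat
    using \<xi> u(1) additive_character_one[OF \<xi>]
    by (induction k) (simp_all add: additive_character_def algebra_simps)
  ultimately have "\<xi> u = 0" using n(1) by simp
  have "D #> g = D #> (u \<otimes> h)"
    using t(2) u hom_mult[OF hom u(1) h] by simp
  then have "\<xi> g = \<xi> (u \<otimes> h)" by (rule \<xi>D[OF g m_closed[OF u(1) h]])
  also have "\<dots> = \<xi> h" using \<xi> u(1) h \<open>\<xi> u = 0\<close> by (simp add: additive_character_def)
  finally show ?thesis .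
qed

end

theorem theorem1p1:
  fixes G :: "('a, 'b) monoid_scheme" and \<mu> :: "'a \<Rightarrow> real"
  assumes "group G"
    and "finitely_generated G"
    and "prob_measure_on G \<mu>"
    and "nondegenerate G \<mu>"
  shows "amenable G \<longleftrightarrow>
    spectral_radius G \<mu> =
      spectral_radius (torsion_free_abelianisation G) (pushforward G (natural_projection G) \<mu>)"
proof -
  interpret group G by fact
  interpret group_measure G \<mu>
    using assms(3) by unfold_locales (auto simp: prob_measure_on_def intro: has_sum_imp_summable)
  show ?thesis
    using assms(4,2) comm_group_torsion_free_abelianisation hom_natural_projection
      natural_projection_surj additive_character_factors
    by (rule amenable_iff_spectral_radius_pushforward)
qed

end
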